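(* For any $M:\mathbf{ZZ}\to\mathbf{set}$ and any finite $I\in\mathbf{Int}(\mathbf{ZZ})$, writing $\mathrm{nbd}(I)=\{a,b\}$, the multiplicity of $I$ in the barcode $\mathrm{barc}^{\mathbf{ZZ}}(L_{\mathbb{F}}\circ M)$ is $$\mathrm{Full}(M)(I)-\mathrm{Full}(M)(I\cup\{a\})-\mathrm{Full}(M)(I\cup\{b\})+\mathrm{Full}(M)(I\cup\{a,b\}),$$ which is also equal to $\mathrm{dgm}^{\mathbf{ZZ}}_{\mathbf{vec}}(L_{\mathbb{F}}\circ M)(I)$.
   Context: $\mathbf{set}$ is the category of finite sets; $\mathbf{vec}$ (resp. $\mathbf{Vec}$) is the category of finite-dimensional (resp. all) vector spaces over a fixed field $\mathbb{F}$. $L_{\mathbb{F}}:\mathbf{Set}\to\mathbf{Vec}$ is the free vector space functor. $\mathbf{ZZ}=\{(i,j)\in\mathbb{Z}^2: j=i\text{ or }j=i-1\}$ with the order inherited from $\mathbb{R}^{\mathrm{op}}\times\mathbb{R}$; thus the nontrivial relations are $(i,i-1)\le(i,i)$ and $(i,i-1)\le(i-1,i-1)$. $\mathbf{Int}(\mathbf{ZZ})$ is the collection of nonempty connected convex subsets of $\mathbf{ZZ}$. For $I\in\mathbf{Int}(\mathbf{ZZ})$, $\mathrm{nbd}(I)$ is the set of $p\in\mathbf{ZZ}\setminus I$ such that $p$ covers or is covered by some $q\in I$; it has exactly two elements when $I$ is finite. In general let $o_I=|\mathrm{nbd}(I)|\in\{0,1,2\}$. For $I\in\mathbf{Int}(\mathbf{ZZ})$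 and $N:I\to\mathbf{set}$ with colimit $(\varinjlim N,(i_k)_{k\in I})$ in $\mathbf{Set}$, the support of $c\in\varinjlim N$ is $\mathrm{supp}(c)=\{k\in I:\exists x_k\in N_k,\ i_k(x_k)=c\}$, and $c$ is a full component of $N$ if $\mathrm{supp}(c)=I$. $\mathrm{Full}(M)(I)$ is the number of full components of $M|_I$. Every $G:\mathbf{ZZ}\to\mathbf{vec}$ is isomorphic to a direct sum $\bigoplus_{\mathcal{J}\in\mathrm{barc}^{\mathbf{ZZ}}(G)}I^{\mathcal{J}}$ for a unique multiset $\mathrm{barc}^{\mathbf{ZZ}}(G)$ of intervals of $\mathbf{ZZ}$ (the barcode), where $I^{\mathcal{J}}$ is the interval module: value $\mathbb{F}$ on $\mathcal{J}$ and $0$ elsewhere, with identity maps between comparable points of $\mathcal{J}$ and zero maps otherwise. $\mathrm{rk}(G)(I)$ is the rank of the canonical map $\varprojlim G|_I\to\varinjlim G|_I$ (the composite through $G_a$ for any $a\in I$), and $\mathrm{dgm}^{\mathbf{ZZ}}_{\mathbf{vec}}(G)(I)=\sum_{S\subset\mathrm{nbd}(I)}(-1)^{|S|}\,\mathrm{rk}(G)(I\cup S)\in\mathbb{Z}$. *)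

theory Defs
  imports "Jordan_Normal_Form.VS_Connect" "HOL-Algebra.AbelCoset"
begin

section \<open>The zigzag poset and its intervals\<close>

type_synonym point = "int \<times> int"

definition ZZ :: "point set" where
  "ZZ = {(i, j). j = i \<or> j = i - 1}"

text \<open>The order inherited from the product of the opposite order on the first coordinate and the
  usual order on the second one.\<close>

definition zz_le :: "point \<Rightarrow> point \<Rightarrow> bool" (infix \<open>\<preceq>\<close> 50) where
  "p \<preceq> q \<longleftrightarrow> fst q \<le> fst p \<and> snd p \<le> snd q"

definition zz_less :: "point \<Rightarrow> point \<Rightarrow> bool" (infix \<open>\<prec>\<close> 50) where
  "p \<prec> q \<longleftrightarrow> p \<preceq> q \<and> p \<noteq> q"

definition covers :: "point \<Rightarrow> point \<Rightarrow> bool" where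
  "covers q p \<longleftrightarrow> p \<prec> q \<and> \<not> (\<exists>r\<in>ZZ. p \<prec> r \<and> r \<prec> q)"

definition zz_convex :: "point set \<Rightarrow> bool" where
  "zz_convex I \<longleftrightarrow> (\<forall>p\<in>I. \<forall>r\<in>I. \<forall>q\<in>ZZ. p \<preceq> q \<and> q \<preceq> r \<longrightarrow> q \<in> I)"

definition zz_connected :: "point set \<Rightarrow> bool" where
  "zz_connected I \<longleftrightarrow>
     (\<forall>p\<in>I. \<forall>q\<in>I. (p, q) \<in> {(x, y). x \<in> I \<and> y \<in> I \<and> (x \<preceq> y \<or> y \<preceq> x)}\<^sup>*)"

definition Int_ZZ :: "point set set" where
  "Int_ZZ = {I. I \<subseteq> ZZ \<and> I \<noteq> {} \<and> zz_connected I \<and> zz_convex I}"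

definition nbd :: "point set \<Rightarrow> point set" where
  "nbd I = {p \<in> ZZ - I. \<exists>q\<in>I. covers p q \<or> covers q p}"


section \<open>Diagrams of sets\<close>

text \<open>A diagram assigns an object to every point and a function to every comparable pair of
  points; only its values on \<^term>\<open>ZZ\<close> matter. Objects are sets, or vector spaces in the form of
  module records of HOL-Algebra.\<close>

record ('o, 'x) diagram =
  Ob :: "point \<Rightarrow> 'o"
  Ar :: "point \<Rightarrow> point \<Rightarrow> 'x \<Rightarrow> 'x"

type_synonym 'a set_diagram = "('a set, 'a) diagram"
type_synonym ('k, 'v) vec_diagram = "(('k, 'v) module, 'v) diagram"

definition finset_functor :: "'a set_diagram \<Rightarrow> bool" where
  "finset_functor M \<longleftrightarrow>
     (\<forall>p\<in>ZZ. finite (Ob M p)) \<and>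
     (\<forall>p\<in>ZZ. \<forall>q\<in>ZZ. p \<preceq> q \<longrightarrow> Ar M p q \<in> Ob M p \<rightarrow> Ob M q) \<and>
     (\<forall>p\<in>ZZ. \<forall>x\<in>Ob M p. Ar M p p x = x) \<and>
     (\<forall>p\<in>ZZ. \<forall>q\<in>ZZ. \<forall>r\<in>ZZ. p \<preceq> q \<longrightarrow> q \<preceq> r \<longrightarrow>
        (\<forall>x\<in>Ob M p. Ar M q r (Ar M p q x) = Ar M p r x))"

text \<open>The colimit in sets of the restriction to \<open>I\<close>: the disjoint union modulo the equivalence
  relation generated by identifying an element with its images.\<close>

definition glue_step :: "'a set_diagram \<Rightarrow> point set \<Rightarrow> ((point \<times> 'a) \<times> (point \<times> 'a)) set" where
  "glue_step M I = {((p, x), (q, y)). p \<in> I \<and> q \<in> I \<and> p \<preceq> q \<and> x \<in> Ob M p \<and> y = Ar M p q x}"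

definition glue :: "'a set_diagram \<Rightarrow> point set \<Rightarrow> ((point \<times> 'a) \<times> (point \<times> 'a)) set" where
  "glue M I = (glue_step M I \<union> (glue_step M I)\<inverse>)\<^sup>*"

definition set_colim :: "'a set_diagram \<Rightarrow> point set \<Rightarrow> (point \<times> 'a) set set" where
  "set_colim M I = (SIGMA p:I. Ob M p) // glue M I"

definition set_colim_in :: "'a set_diagram \<Rightarrow> point set \<Rightarrow> point \<Rightarrow> 'a \<Rightarrow> (point \<times> 'a) set" where
  "set_colim_in M I k x = glue M I `` {(k, x)}"

definition supp :: "'a set_diagram \<Rightarrow> point set \<Rightarrow> (point \<times> 'a) set \<Rightarrow> point set" where
  "supp M I c = {k \<in> I. \<exists>x\<in>Ob M k. set_colim_in M I k x = c}"

definition Full :: "'a set_diagram \<Rightarrow> point set \<Rightarrow> nat" where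
  "Full M I = card {c \<in> set_colim M I. supp M I c = I}"


section \<open>Constructions with vector spaces\<close>

text \<open>The fields \<open>mult\<close> and \<open>one\<close> of a module record play no role and are filled with dummy values.\<close>

definition free_vs :: "'a set \<Rightarrow> ('k::field, 'a \<Rightarrow> 'k) module" where
  "free_vs X =
     \<lparr>carrier = {f. finite {x. f x \<noteq> 0} \<and> {x. f x \<noteq> 0} \<subseteq> X},
      mult = (\<lambda>_ _ _. 0), one = (\<lambda>_. 0),
      zero = (\<lambda>_. 0), add = (\<lambda>f g x. f x + g x),
      smult = (\<lambda>c f x. c * f x)\<rparr>"

text \<open>The linear extension of \<open>\<phi>\<close>.\<close>

definition free_map :: "('a \<Rightarrow> 'b) \<Rightarrow> ('a \<Rightarrow> 'k::field) \<Rightarrow> 'b \<Rightarrow> 'k" where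
  "free_map \<phi> f = (\<lambda>y. \<Sum>x | f x \<noteq> 0 \<and> \<phi> x = y. f x)"

definition vs_prod :: "'i set \<Rightarrow> ('i \<Rightarrow> ('k, 'v) module) \<Rightarrow> ('k, 'i \<Rightarrow> 'v) module" where
  "vs_prod A V =
     \<lparr>carrier = (\<Pi>\<^sub>E i\<in>A. carrier (V i)),
      mult = (\<lambda>_ _. \<lambda>i\<in>A. \<zero>\<^bsub>V i\<^esub>), one = (\<lambda>i\<in>A. \<zero>\<^bsub>V i\<^esub>),
      zero = (\<lambda>i\<in>A. \<zero>\<^bsub>V i\<^esub>), add = (\<lambda>x y. \<lambda>i\<in>A. x i \<oplus>\<^bsub>V i\<^esub> y i),
      smult = (\<lambda>c x. \<lambda>i\<in>A. c \<odot>\<^bsub>V i\<^esub> x i)\<rparr>"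

definition vs_dsum :: "'i set \<Rightarrow> ('i \<Rightarrow> ('k, 'v) module) \<Rightarrow> ('k, 'i \<Rightarrow> 'v) module" where
  "vs_dsum A V = (vs_prod A V)
     \<lparr>carrier := {x \<in> carrier (vs_prod A V). finite {i \<in> A. x i \<noteq> \<zero>\<^bsub>V i\<^esub>}}\<rparr>"

definition vs_dsum_in :: "'i set \<Rightarrow> ('i \<Rightarrow> ('k, 'v) module) \<Rightarrow> 'i \<Rightarrow> 'v \<Rightarrow> 'i \<Rightarrow> 'v" where
  "vs_dsum_in A V k v = (\<lambda>i\<in>A. if i = k then v else \<zero>\<^bsub>V i\<^esub>)"

text \<open>The quotient of \<open>V\<close> by a subspace \<open>W\<close>. The union in \<open>smult\<close> is over one and the same coset
  for every representative \<open>a\<close>.\<close>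

definition vs_quot :: "('k, 'v) module \<Rightarrow> 'v set \<Rightarrow> ('k, 'v set) module" where
  "vs_quot V W =
     \<lparr>carrier = a_rcosets\<^bsub>V\<^esub> W,
      mult = (\<lambda>_ _. W), one = W,
      zero = W, add = set_add V,
      smult = (\<lambda>c A. \<Union>a\<in>A. W +>\<^bsub>V\<^esub> (c \<odot>\<^bsub>V\<^esub> a))\<rparr>"


section \<open>Diagrams of vector spaces\<close>

definition free_diagram :: "'a set_diagram \<Rightarrow> ('k::field, 'a \<Rightarrow> 'k) vec_diagram" where
  "free_diagram M = \<lparr>Ob = (\<lambda>p. free_vs (Ob M p)), Ar = (\<lambda>p q. free_map (Ar M p q))\<rparr>"

definition vec_lim :: "('k::field, 'v) vec_diagram \<Rightarrow> point set \<Rightarrow> ('k, point \<Rightarrow> 'v) module" where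
  "vec_lim G I = (vs_prod I (Ob G))
     \<lparr>carrier := {x \<in> carrier (vs_prod I (Ob G)).
                    \<forall>p\<in>I. \<forall>q\<in>I. p \<preceq> q \<longrightarrow> Ar G p q (x p) = x q}\<rparr>"

definition vec_glue :: "('k::field, 'v) vec_diagram \<Rightarrow> point set \<Rightarrow> (point \<Rightarrow> 'v) set" where
  "vec_glue G I = LinearCombinations.module.span class_ring (vs_dsum I (Ob G))
     {vs_dsum_in I (Ob G) p v \<ominus>\<^bsub>vs_dsum I (Ob G)\<^esub> vs_dsum_in I (Ob G) q (Ar G p q v) | p q v.
        p \<in> I \<and> q \<in> I \<and> p \<preceq> q \<and> v \<in> carrier (Ob G p)}"

definition vec_colim :: "('k::field, 'v) vec_diagram \<Rightarrow> point set \<Rightarrow> ('k, (point \<Rightarrow> 'v) set) module" where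
  "vec_colim G I = vs_quot (vs_dsum I (Ob G)) (vec_glue G I)"

definition vec_colim_in ::
    "('k::field, 'v) vec_diagram \<Rightarrow> point set \<Rightarrow> point \<Rightarrow> 'v \<Rightarrow> (point \<Rightarrow> 'v) set" where
  "vec_colim_in G I k v = vec_glue G I +>\<^bsub>vs_dsum I (Ob G)\<^esub> vs_dsum_in I (Ob G) k v"

text \<open>For an interval \<open>I\<close> and a functor \<open>G\<close> the composite does not depend on the chosen point of
  \<open>I\<close>, since \<open>I\<close> is connected.\<close>

definition lim_to_colim ::
    "('k::field, 'v) vec_diagram \<Rightarrow> point set \<Rightarrow> (point \<Rightarrow> 'v) \<Rightarrow> (point \<Rightarrow> 'v) set" where
  "lim_to_colim G I x = (let a = (SOME a. a \<in> I) in vec_colim_in G I a (x a))"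

definition rk :: "('k::field, 'v) vec_diagram \<Rightarrow> point set \<Rightarrow> nat" where
  "rk G I = vectorspace.dim class_ring
     ((vec_colim G I)\<lparr>carrier := lim_to_colim G I ` carrier (vec_lim G I)\<rparr>)"

definition dgm :: "('k::field, 'v) vec_diagram \<Rightarrow> point set \<Rightarrow> int" where
  "dgm G I = (\<Sum>S\<in>Pow (nbd I). (- 1) ^ card S * int (rk G (I \<union> S)))"

definition interval_module :: "point set \<Rightarrow> ('k::field, 'k) vec_diagram" where
  "interval_module J =
     \<lparr>Ob = (\<lambda>p. \<lparr>carrier = (if p \<in> J then UNIV else {0}), mult = (*), one = 1,
                 zero = 0, add = (+), smult = (*)\<rparr>),
      Ar = (\<lambda>p q v. if p \<in> J \<and> q \<in> J then v else 0)\<rparr>"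

definition dsum_diagram ::
    "'i set \<Rightarrow> ('i \<Rightarrow> ('k::field, 'v) vec_diagram) \<Rightarrow> ('k, 'i \<Rightarrow> 'v) vec_diagram" where
  "dsum_diagram A F =
     \<lparr>Ob = (\<lambda>p. vs_dsum A (\<lambda>i. Ob (F i) p)),
      Ar = (\<lambda>p q x. \<lambda>i\<in>A. Ar (F i) p q (x i))\<rparr>"

definition vec_diagram_iso :: "('k::field, 'v) vec_diagram \<Rightarrow> ('k, 'w) vec_diagram \<Rightarrow> bool" where
  "vec_diagram_iso G H \<longleftrightarrow> (\<exists>\<eta>.
     (\<forall>p\<in>ZZ. \<eta> p \<in> LinearCombinations.module_hom class_ring (Ob G p) (Ob H p) \<and>
             bij_betw (\<eta> p) (carrier (Ob G p)) (carrier (Ob H p))) \<and>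
     (\<forall>p\<in>ZZ. \<forall>q\<in>ZZ. p \<preceq> q \<longrightarrow>
        (\<forall>v\<in>carrier (Ob G p). \<eta> q (Ar G p q v) = Ar H p q (\<eta> p v))))"

text \<open>A barcode may contain infinitely many intervals, so it is not a value of the type of finite
  multisets; it is given by its multiplicity function \<open>B\<close>. Multiplicities are finite, since the
  vector spaces in question are finite-dimensional and intervals are nonempty. The copies of an
  interval \<open>J\<close> are indexed by the pairs \<open>(J, n)\<close> with \<open>n < B J\<close>.\<close>

definition is_barcode :: "('k::field, 'v) vec_diagram \<Rightarrow> (point set \<Rightarrow> nat) \<Rightarrow> bool" where
  "is_barcode G B \<longleftrightarrow>
     (\<forall>J. J \<notin> Int_ZZ \<longrightarrow> B J = 0) \<and>
     vec_diagram_iso G (dsum_diagram {(J, n). n < B J} (\<lambda>(J, n). interval_module J))"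

end

theory Submission
  imports Defs
begin

text \<open>Let \<open>J\<close> be a finite interval. The colimit of \<open>L \<circ> M\<close> over \<open>J\<close> is free on the components of \<open>M\<close>
  restricted to \<open>J\<close>, and the image of a section of \<open>L \<circ> M\<close> has coefficient \<open>0\<close> at every component that
  misses a point of \<open>J\<close>; so the image of the limit lies in the span of the full components. It is this whole
  span: a walk in the category of elements from the left end of \<open>J\<close> to the right end, counted with signs
  according to its direction, is a section concentrated on one component. Hence the rank over \<open>J\<close> is the number of
  full components. The number of bars that contain \<open>J\<close> is the same, since evaluating full components on these
  bars gives an invertible matrix. Inclusion-exclusion over the bars that contain \<open>I\<close>, according to whether
  they contain the two neighbours of \<open>I\<close>, then leaves exactly the copies of \<open>I\<close>.\<close>

section \<open>Linear algebra\<close>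

text \<open>Rank and bars are each compared with full components, never with each other; this avoids
  computing limits and colimits of a sum of interval modules. The comparison with bars takes place
  at the left end of \<open>J\<close> and uses two matrices: \<open>P d c\<close> is the coordinate
  on the bar \<open>d\<close> of an element of the component \<open>c\<close>, and
  \<open>Q c d\<close> is the total over \<open>c\<close> of the vector of \<open>d\<close>. The
  product over components is the identity because the vector of a bar containing \<open>J\<close> is
  a section, so its totals live on full components. The product over bars is harder: an element at
  the left end expands in all bars through that end, also in those that stop inside
  \<open>J\<close>. If such a bar stops along an arrow leaving it, the arrow kills its vector and
  with it the totals; if along an arrow entering it, a section has coordinate 0 on it. Finiteness of
  the set of bars containing \<open>J\<close> is not given in advance. Hence the cardinalities are
  compared by one-sided inverses over finite index sets: the first product bounds every finite set
  of these bars.\<close>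

lemma card_le_of_left_inverse:
  fixes P :: "'d \<Rightarrow> 'c \<Rightarrow> 'k::field" and Q :: "'c \<Rightarrow> 'd \<Rightarrow> 'k"
  assumes "finite C" "finite D"
    and inv: "\<And>d d'. d \<in> D \<Longrightarrow> d' \<in> D \<Longrightarrow> (\<Sum>c\<in>C. P d c * Q c d') = (if d = d' then 1 else 0)"
  shows "card D \<le> card C"
proof (rule ccontr)
  assume "\<not> card D \<le> card C"
  define m n where "m = card D" and "n = card C"
  have nm: "n < m" using \<open>\<not> card D \<le> card C\<close> by (simp add: m_def n_def)
  obtain e where e: "bij_betw e {0..<n} C"
    using ex_bij_betw_nat_finite[OF assms(1)] n_def by blast
  obtain f where f: "bij_betw f {0..<m} D"
    using ex_bij_betw_nat_finite[OF assms(2)] m_def by blast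
  define A where "A = mat m m (\<lambda>(i, j). if i < n then Q (e i) (f j) else 0)"
  define B where "B = mat m m (\<lambda>(i, j). if j < n then P (f i) (e j) else 0)"
  have A: "A \<in> carrier_mat m m" and B: "B \<in> carrier_mat m m" by (auto simp: A_def B_def)
  \<comment> \<open>Padded with zeros to square matrices, the factors have determinants with product \<open>1\<close>,
    although \<open>A\<close> has a zero row.\<close>
  have "B * A = 1\<^sub>m m"
  proof (rule eq_matI)
    fix i j assume ij: "i < dim_row (1\<^sub>m m :: 'k mat)" "j < dim_col (1\<^sub>m m :: 'k mat)"
    then have i: "i < m" and j: "j < m" by auto
    have "(B * A) $$ (i, j) = (\<Sum>k = 0..<m. B $$ (i, k) * A $$ (k, j))"
      using i j A B by (simp add: scalar_prod_def)
    also have "\<dots> = (\<Sum>k = 0..<n. P (f i) (e k) * Q (e k) (f j))"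
      using i j nm by (intro sum.mono_neutral_cong_right) (auto simp: A_def B_def)
    also have "\<dots> = (\<Sum>c\<in>C. P (f i) c * Q c (f j))"
      by (rule sum.reindex_bij_betw[OF e])
    also have "\<dots> = (if f i = f j then 1 else 0)"
      using i j f by (intro inv) (auto simp: bij_betw_def)
    also have "\<dots> = 1\<^sub>m m $$ (i, j)"
      using i j f by (auto simp: bij_betw_def inj_on_def)
    finally show "(B * A) $$ (i, j) = 1\<^sub>m m $$ (i, j)" .
  qed (use A B in auto)
  then have "det B * det A = 1" using det_mult[OF B A] by simp
  moreover have "det A = 0"
  proof -
    have "A\<^sup>T *\<^sub>v unit_vec m n = 0\<^sub>v m"
    proof (rule eq_vecI)
      fix i assume "i < dim_vec (0\<^sub>v m :: 'k vec)"
      then have i: "i < m" by simp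
      have "(A\<^sup>T *\<^sub>v unit_vec m n) $ i = A $$ (n, i)"
        using i nm A by (auto simp: scalar_prod_right_unit)
      then show "(A\<^sup>T *\<^sub>v unit_vec m n) $ i = 0\<^sub>v m $ i" using i nm by (simp add: A_def)
    qed (use A in auto)
    then have "det A\<^sup>T = 0"
      using A nm unit_vec_nonzero[of n m]
      by (subst det_0_iff_vec_prod_zero_field[of _ m]) (auto intro!: exI[of _ "unit_vec m n"])
    then show ?thesis using A by (simp add: det_transpose)
  qed
  ultimately show False by simp
qed

lemma carrier_free_vs:
  "finite X \<Longrightarrow> f \<in> carrier (free_vs X) \<longleftrightarrow> (\<forall>x. x \<notin> X \<longrightarrow> f x = 0)"
  by (auto simp: free_vs_def intro: finite_subset)

lemma free_vs_simps [simp]: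
  "f \<oplus>\<^bsub>free_vs X\<^esub> g = (\<lambda>x. f x + g x)"
  "\<zero>\<^bsub>free_vs X\<^esub> = (\<lambda>x. 0)"
  "c \<odot>\<^bsub>free_vs X\<^esub> f = (\<lambda>x. c * f x)"
  by (simp_all add: free_vs_def)

text \<open>\<open>rk\<close> is the \<open>dim\<close> of a colimit record whose carrier has been
  replaced by an image, so no vector space structure is given in advance. The axioms are pulled back
  along \<theta> to pointwise computations with functions, and the dimension is that of
  \<open>carrier_vec\<close>, with coordinates enumerated by \<open>C\<close>.\<close>

lemma dim_eq_card_if_bij:
  fixes X :: "('k::field, 'b) module" and C :: "'c set" and \<theta> :: "('c \<Rightarrow> 'k) \<Rightarrow> 'b"
  assumes C: "finite C"
    and bij: "bij_betw \<theta> (carrier (free_vs C)) (carrier X)"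
    and add: "\<And>f g. f \<in> carrier (free_vs C) \<Longrightarrow> g \<in> carrier (free_vs C) \<Longrightarrow>
      \<theta> f \<oplus>\<^bsub>X\<^esub> \<theta> g = \<theta> (\<lambda>x. f x + g x)"
    and zero: "\<zero>\<^bsub>X\<^esub> = \<theta> (\<lambda>x. 0)"
    and smult: "\<And>a f. f \<in> carrier (free_vs C) \<Longrightarrow> a \<odot>\<^bsub>X\<^esub> \<theta> f = \<theta> (\<lambda>x. a * f x)"
  shows "vectorspace.dim class_ring X = card C"
proof -
  have im: "carrier X = \<theta> ` carrier (free_vs C)" using bij by (simp add: bij_betw_def)
  note cf = carrier_free_vs[OF C]
  have vs: "vectorspace class_ring X"
  proof (rule vs_criteria[OF class_field])
    show "\<zero>\<^bsub>X\<^esub> \<in> carrier X" by (auto simp: im zero cf)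
    show "\<forall>v\<in>carrier X. \<exists>w\<in>carrier X. v \<oplus>\<^bsub>X\<^esub> w = \<zero>\<^bsub>X\<^esub>"
    proof
      fix v assume "v \<in> carrier X"
      then obtain f where f: "f \<in> carrier (free_vs C)" "v = \<theta> f" by (auto simp: im)
      have "(\<lambda>x. - f x) \<in> carrier (free_vs C)" using f by (simp add: cf)
      then show "\<exists>w\<in>carrier X. v \<oplus>\<^bsub>X\<^esub> w = \<zero>\<^bsub>X\<^esub>"
        using f by (intro bexI[of _ "\<theta> (\<lambda>x. - f x)"]) (auto simp: add zero im)
    qed
  qed (auto simp: im add zero smult cf algebra_simps)
  define n where "n = card C"
  obtain e where e: "bij_betw e C {0..<n}"
    using ex_bij_betw_finite_nat[OF C] n_def by blast
  define \<iota> where "\<iota> v = (\<lambda>c. if c \<in> C then v $ e c else 0)" for v :: "'k vec"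
  have e': "e c < n" if "c \<in> C" for c using that e by (auto simp: bij_betw_def)
  have \<iota>: "\<iota> v \<in> carrier (free_vs C)" for v by (simp add: \<iota>_def cf)
  interpret V: vec_space "TYPE('k)" n .
  interpret X: vectorspace class_ring X by (rule vs)
  have bij_\<iota>: "bij_betw \<iota> (carrier_vec n) (carrier (free_vs C))"
  proof (rule bij_betwI[where g = "\<lambda>f. vec n (\<lambda>i. f (inv_into C e i))"])
    show "vec n (\<lambda>i. \<iota> v (inv_into C e i)) = v" if "v \<in> carrier_vec n" for v
    proof (rule eq_vecI)
      fix i assume "i < dim_vec v"
      then have i: "i < n" using that by simp
      then have "i \<in> e ` C" using e by (auto simp: bij_betw_def)
      then show "vec n (\<lambda>i. \<iota> v (inv_into C e i)) $ i = v $ i"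
        using i by (simp add: \<iota>_def inv_into_into f_inv_into_f)
    qed (use that in simp)
    show "\<iota> (vec n (\<lambda>i. f (inv_into C e i))) = f" if "f \<in> carrier (free_vs C)" for f
      using that e e' by (fastforce simp: \<iota>_def cf bij_betw_def)
  qed (use \<iota> in auto)
  have lin: "linear_map class_ring V.V X (\<theta> \<circ> \<iota>)"
  proof (intro linear_map.intro mod_hom.intro mod_hom_axioms.intro V.vectorspace_axioms vs)
    show "\<theta> \<circ> \<iota> \<in> LinearCombinations.module_hom class_ring V.V X"
      unfolding LinearCombinations.module_hom_def
    proof (intro CollectI conjI allI impI)
      show "\<theta> \<circ> \<iota> \<in> carrier V.V \<rightarrow> carrier X" using \<iota> by (auto simp: im)
      fix v w assume "v \<in> carrier V.V \<and> w \<in> carrier V.V"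
      then have vw: "v \<in> carrier_vec n" "w \<in> carrier_vec n" by auto
      have "\<iota> (v + w) = (\<lambda>c. \<iota> v c + \<iota> w c)" using vw e' by (auto simp: \<iota>_def)
      then show "(\<theta> \<circ> \<iota>) (v \<oplus>\<^bsub>V.V\<^esub> w) = (\<theta> \<circ> \<iota>) v \<oplus>\<^bsub>X\<^esub> (\<theta> \<circ> \<iota>) w"
        by (simp add: add \<iota>)
    next
      fix a :: 'k and v assume "a \<in> carrier class_ring \<and> v \<in> carrier V.V"
      then have "v \<in> carrier_vec n" by auto
      then have "\<iota> (a \<cdot>\<^sub>v v) = (\<lambda>c. a * \<iota> v c)" using e' by (auto simp: \<iota>_def)
      then show "(\<theta> \<circ> \<iota>) (a \<odot>\<^bsub>V.V\<^esub> v) = a \<odot>\<^bsub>X\<^esub> (\<theta> \<circ> \<iota>) v"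
        by (simp add: smult \<iota>)
    qed
  qed (auto intro: V.module_axioms X.module_axioms)
  have "bij_betw (\<theta> \<circ> \<iota>) (carrier_vec n) (carrier X)"
    by (rule bij_betw_trans[OF bij_\<iota> bij])
  then have "V.dim = X.dim"
    by (intro linear_map.dim_eq[OF lin]) (auto simp: bij_betw_def)
  then show ?thesis using V.dim_is_n n_def by simp
qed

section \<open>Module structures on free spaces and on products\<close>

lemma module_free_vs: "module class_ring (free_vs X :: ('k::field, 'a \<Rightarrow> 'k) module)"
proof (rule module_criteria)
  show "cring (class_ring :: 'k ring)" by (rule class_cring.cring_axioms)
  have fin: "finite {x. f x + g x \<noteq> 0}" if "finite {x. f x \<noteq> 0}" "finite {x. g x \<noteq> 0}"
    for f g :: "'a \<Rightarrow> 'k"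
    by (rule finite_subset[OF _ finite_UnI[OF that]]) auto
  show "\<forall>v w. v \<in> carrier (free_vs X) \<and> w \<in> carrier (free_vs X) \<longrightarrow>
      v \<oplus>\<^bsub>free_vs X\<^esub> w \<in> carrier (free_vs X :: ('k, 'a \<Rightarrow> 'k) module)"
    by (auto simp: free_vs_def fin) (metis (mono_tags) add.right_neutral mem_Collect_eq subsetD)
  show "\<forall>v\<in>carrier (free_vs X). \<exists>w\<in>carrier (free_vs X :: ('k, 'a \<Rightarrow> 'k) module).
      v \<oplus>\<^bsub>free_vs X\<^esub> w = \<zero>\<^bsub>free_vs X\<^esub>"
  proof
    fix v :: "'a \<Rightarrow> 'k" assume "v \<in> carrier (free_vs X)"
    then show "\<exists>w\<in>carrier (free_vs X). v \<oplus>\<^bsub>free_vs X\<^esub> w = \<zero>\<^bsub>free_vs X\<^esub>"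
      by (intro bexI[of _ "\<lambda>x. - v x"]) (auto simp: free_vs_def)
  qed
  show "\<forall>c v. c \<in> carrier class_ring \<and> v \<in> carrier (free_vs X) \<longrightarrow>
      c \<odot>\<^bsub>free_vs X\<^esub> v \<in> carrier (free_vs X :: ('k, 'a \<Rightarrow> 'k) module)"
    by (auto simp: free_vs_def)
qed (auto simp: free_vs_def algebra_simps)

lemma module_vs_prod:
  fixes V :: "'i \<Rightarrow> ('k::field, 'v) module"
  assumes "\<And>i. i \<in> A \<Longrightarrow> module class_ring (V i)"
  shows "module class_ring (vs_prod A V)"
proof (rule module_criteria)
  have m: "module class_ring (V i)" if "i \<in> A" for i using assms that .
  have g: "abelian_group (V i)" if "i \<in> A" for i using m[OF that] by (rule module.axioms(2))
  note agm = abelian_monoid.a_closed[OF abelian_group.axioms(1)[OF g]]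
    abelian_monoid.zero_closed[OF abelian_group.axioms(1)[OF g]]
  show "cring (class_ring :: 'k ring)" by (rule class_cring.cring_axioms)
  show "\<zero>\<^bsub>vs_prod A V\<^esub> \<in> carrier (vs_prod A V)" using agm by (auto simp: vs_prod_def)
  show "\<forall>v w. v \<in> carrier (vs_prod A V) \<and> w \<in> carrier (vs_prod A V) \<longrightarrow>
      v \<oplus>\<^bsub>vs_prod A V\<^esub> w \<in> carrier (vs_prod A V)"
    using agm by (auto simp: vs_prod_def PiE_iff)
  show "\<forall>v\<in>carrier (vs_prod A V). \<exists>w\<in>carrier (vs_prod A V).
      v \<oplus>\<^bsub>vs_prod A V\<^esub> w = \<zero>\<^bsub>vs_prod A V\<^esub>"
  proof
    fix v assume v: "v \<in> carrier (vs_prod A V)"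
    have "v i \<oplus>\<^bsub>V i\<^esub> \<ominus>\<^bsub>V i\<^esub> v i = \<zero>\<^bsub>V i\<^esub>" "\<ominus>\<^bsub>V i\<^esub> v i \<in> carrier (V i)" if "i \<in> A" for i
      using v that by (auto simp: vs_prod_def PiE_iff intro!: abelian_group.r_neg[OF g] abelian_group.a_inv_closed[OF g])
    then show "\<exists>w\<in>carrier (vs_prod A V). v \<oplus>\<^bsub>vs_prod A V\<^esub> w = \<zero>\<^bsub>vs_prod A V\<^esub>"
      by (intro bexI[of _ "\<lambda>i\<in>A. \<ominus>\<^bsub>V i\<^esub> v i"]) (auto simp: vs_prod_def cong: restrict_cong)
  qed
  show "\<forall>c v. c \<in> carrier class_ring \<and> v \<in> carrier (vs_prod A V) \<longrightarrow>
      c \<odot>\<^bsub>vs_prod A V\<^esub> v \<in> carrier (vs_prod A V)"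
    using module.smult_closed[OF m] by (auto simp: vs_prod_def PiE_iff)
  show "\<forall>v\<in>carrier (vs_prod A V). v \<oplus>\<^bsub>vs_prod A V\<^esub> \<zero>\<^bsub>vs_prod A V\<^esub> = v"
    using abelian_monoid.r_zero[OF abelian_group.axioms(1)[OF g]]
    by (auto simp: vs_prod_def PiE_iff fun_eq_iff restrict_def PiE_def extensional_def)
  show "\<forall>v\<in>carrier (vs_prod A V). \<one>\<^bsub>class_ring\<^esub> \<odot>\<^bsub>vs_prod A V\<^esub> v = v"
    using module.smult_one[OF m]
    by (auto simp: vs_prod_def PiE_iff fun_eq_iff restrict_def PiE_def extensional_def)
  show "\<forall>v w. v \<in> carrier (vs_prod A V) \<and> w \<in> carrier (vs_prod A V) \<longrightarrow>
      v \<oplus>\<^bsub>vs_prod A V\<^esub> w = w \<oplus>\<^bsub>vs_prod A V\<^esub> v"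
    using abelian_monoid.a_comm[OF abelian_group.axioms(1)[OF g]]
    by (auto simp: vs_prod_def PiE_iff intro!: restrict_ext)
  show "\<forall>v w x. v \<in> carrier (vs_prod A V) \<and> w \<in> carrier (vs_prod A V) \<and> x \<in> carrier (vs_prod A V) \<longrightarrow>
      v \<oplus>\<^bsub>vs_prod A V\<^esub> w \<oplus>\<^bsub>vs_prod A V\<^esub> x = v \<oplus>\<^bsub>vs_prod A V\<^esub> (w \<oplus>\<^bsub>vs_prod A V\<^esub> x)"
    using abelian_monoid.a_assoc[OF abelian_group.axioms(1)[OF g]]
    by (auto simp: vs_prod_def PiE_iff intro!: restrict_ext)
  show "\<forall>a b v. a \<in> carrier class_ring \<and> b \<in> carrier class_ring \<and> v \<in> carrier (vs_prod A V) \<longrightarrow>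
      (a \<otimes>\<^bsub>class_ring\<^esub> b) \<odot>\<^bsub>vs_prod A V\<^esub> v = a \<odot>\<^bsub>vs_prod A V\<^esub> (b \<odot>\<^bsub>vs_prod A V\<^esub> v)"
    using module.smult_assoc1[OF m] by (auto simp: vs_prod_def PiE_iff intro!: restrict_ext)
  show "\<forall>a b v. a \<in> carrier class_ring \<and> b \<in> carrier class_ring \<and> v \<in> carrier (vs_prod A V) \<longrightarrow>
      (a \<oplus>\<^bsub>class_ring\<^esub> b) \<odot>\<^bsub>vs_prod A V\<^esub> v = a \<odot>\<^bsub>vs_prod A V\<^esub> v \<oplus>\<^bsub>vs_prod A V\<^esub> b \<odot>\<^bsub>vs_prod A V\<^esub> v"
    using module.smult_l_distr[OF m] by (auto simp: vs_prod_def PiE_iff intro!: restrict_ext)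
  show "\<forall>a v w. a \<in> carrier class_ring \<and> v \<in> carrier (vs_prod A V) \<and> w \<in> carrier (vs_prod A V) \<longrightarrow>
      a \<odot>\<^bsub>vs_prod A V\<^esub> (v \<oplus>\<^bsub>vs_prod A V\<^esub> w) = a \<odot>\<^bsub>vs_prod A V\<^esub> v \<oplus>\<^bsub>vs_prod A V\<^esub> a \<odot>\<^bsub>vs_prod A V\<^esub> w"
    using module.smult_r_distr[OF m] by (auto simp: vs_prod_def PiE_iff intro!: restrict_ext)
qed

lemma vs_dsum_finite: "finite A \<Longrightarrow> vs_dsum A V = vs_prod A V"
  by (simp add: vs_dsum_def vs_prod_def)

section \<open>The zigzag poset and components of diagrams\<close>

text \<open>Numbers the points along the zigzag; the odd ones are minimal.\<close>

definition pt :: "int \<Rightarrow> point" where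
  "pt n = ((n + 1) div 2, n div 2)"

lemma inj_pt: "inj pt"
proof (rule injI)
  fix m n :: int assume "pt m = pt n"
  then show "m = n" unfolding pt_def prod.inject by presburger
qed

lemma pt_eq_iff [simp]: "pt m = pt n \<longleftrightarrow> m = n"
  using inj_pt by (auto simp: inj_def)

lemma pt_pos:
  assumes "(i, j) \<in> ZZ"
  shows "pt (i + j) = (i, j)"
  using assms by (auto simp: ZZ_def pt_def)

lemma pt_in_ZZ [simp]: "pt n \<in> ZZ"
  unfolding ZZ_def pt_def by simp presburger

lemma ZZ_eq: "ZZ = range pt"
proof (rule Set.set_eqI)
  fix p :: point
  show "p \<in> ZZ \<longleftrightarrow> p \<in> range pt"
    using pt_pos[of "fst p" "snd p"] by (auto simp: image_iff) metis
qed

text \<open>The point numbered 2i-1 is (i, i-1). Strictly above it lie just (i, i) and (i-1, i-1),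
  which have the numbers 2i and 2i-2.\<close>

lemma pt_le_iff: "pt m \<preceq> pt n \<longleftrightarrow> m = n \<or> odd m \<and> (n = m + 1 \<or> n = m - 1)"
proof -
  have half: "k = 2 * (k div 2) \<or> k = 2 * ((k + 1) div 2) - 1" for k :: int by presburger
  obtain i j where "m = 2 * i \<or> m = 2 * i - 1" "n = 2 * j \<or> n = 2 * j - 1"
    using half[of m] half[of n] by blast
  then show ?thesis
    by (elim disjE) (auto simp: zz_le_def pt_def, presburger)
qed

lemma covers_pt_iff: "covers (pt m) (pt n) \<longleftrightarrow> odd n \<and> (m = n + 1 \<or> m = n - 1)"
  by (auto simp: covers_def zz_less_def pt_le_iff ZZ_eq)

text \<open>Each step of a chain of comparable points changes the number by at most 1, so a chain
  inside \<open>K\<close> from \<open>x\<close> to \<open>z\<close> skips nothing in between. The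
  induction keeps track of the whole stretch between \<open>x\<close> and the current point.\<close>

lemma Int_ZZ_between:
  assumes K: "K \<in> Int_ZZ" and xz: "pt x \<in> K" "pt z \<in> K" and y: "x \<le> y" "y \<le> z"
  shows "pt y \<in> K"
proof -
  let ?R = "{(p, q). p \<in> K \<and> q \<in> K \<and> (p \<preceq> q \<or> q \<preceq> p)}"
  have "(pt x, pt z) \<in> ?R\<^sup>*"
    using K xz by (auto simp: Int_ZZ_def zz_connected_def)
  then have "\<exists>w. pt z = pt w \<and> (\<forall>y. min x w \<le> y \<and> y \<le> max x w \<longrightarrow> pt y \<in> K)"
  proof (induction rule: rtrancl_induct)
    case base
    show ?case using xz by (intro exI[of _ x]) auto
  next
    case (step p q)
    then obtain w where w: "p = pt w" "\<And>y. min x w \<le> y \<Longrightarrow> y \<le> max x w \<Longrightarrow> pt y \<in> K" by auto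
    have "q \<in> ZZ" using step K by (auto simp: Int_ZZ_def)
    then obtain w' where w': "q = pt w'" by (auto simp: ZZ_eq)
    have "w' = w \<or> w' = w + 1 \<or> w' = w - 1" and "pt w' \<in> K"
      using step w w' by (auto simp: pt_le_iff)
    then have "pt y \<in> K" if "min x w' \<le> y" "y \<le> max x w'" for y
      using that w(2)[of y] by (cases "y = w'") (auto simp: min_def max_def split: if_splits)
    then show ?case using w' by auto
  qed
  then show ?thesis using y by auto
qed

lemma finite_Int_ZZ_eq:
  assumes "K \<in> Int_ZZ" "finite K"
  obtains l r where "l \<le> r" "K = pt ` {l..r}"
proof -
  define N where "N = pt -` K"
  have K: "K = pt ` N" using assms by (auto simp: N_def Int_ZZ_def ZZ_eq)
  have "finite N" unfolding N_def by (rule finite_vimageI[OF assms(2) inj_pt])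
  moreover have "N \<noteq> {}" using assms(1) K by (auto simp: Int_ZZ_def)
  ultimately have N: "finite N" "N \<noteq> {}" by auto
  have "N = {Min N..Max N}"
  proof (rule Set.set_eqI)
    fix y
    have "pt y \<in> K" if "Min N \<le> y" "y \<le> Max N"
      using Int_ZZ_between[OF assms(1) _ _ that] Min_in[OF N] Max_in[OF N] by (simp add: N_def)
    then show "y \<in> N \<longleftrightarrow> y \<in> {Min N..Max N}"
      using Min_le[OF N(1), of y] Max_ge[OF N(1), of y] by (auto simp: N_def)
  qed
  then show ?thesis using that[of "Min N" "Max N"] N K by simp
qed

lemma nbd_pt: "l \<le> r \<Longrightarrow> nbd (pt ` {l..r}) = {pt (l - 1), pt (r + 1)}"
proof -
  assume lr: "l \<le> r"
  have "pt m \<in> nbd (pt ` {l..r}) \<longleftrightarrow> m \<notin> {l..r} \<and> (\<exists>n\<in>{l..r}. m = n + 1 \<or> m = n - 1)" for m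
  proof -
    have "covers (pt m) (pt n) \<or> covers (pt n) (pt m) \<longleftrightarrow> m = n + 1 \<or> m = n - 1" for n
      unfolding covers_pt_iff by auto
    then show ?thesis by (auto simp: nbd_def)
  qed
  also have "\<dots> m \<longleftrightarrow> m = l - 1 \<or> m = r + 1" for m
    using lr by (auto intro: bexI[of _ l] bexI[of _ r])
  finally have *: "pt m \<in> nbd (pt ` {l..r}) \<longleftrightarrow> m = l - 1 \<or> m = r + 1" for m .
  show ?thesis
  proof (rule Set.set_eqI)
    fix p
    show "p \<in> nbd (pt ` {l..r}) \<longleftrightarrow> p \<in> {pt (l - 1), pt (r + 1)}"
    proof (cases "p \<in> ZZ")
      case True
      then obtain m where "p = pt m" by (auto simp: ZZ_eq)
      then show ?thesis using * by simp
    qed (auto simp: nbd_def)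
  qed
qed

text \<open>A further point of \<open>K\<close> on one side would force the neighbour on that side
  into \<open>K\<close>. Finiteness of \<open>K\<close> is not assumed, because the lemma is applied
  to bars, which may be infinite.\<close>

lemma Int_ZZ_eqI:
  assumes K: "K \<in> Int_ZZ" and "l \<le> r" and sub: "pt ` {l..r} \<subseteq> K"
    and "pt (l - 1) \<notin> K" "pt (r + 1) \<notin> K"
  shows "K = pt ` {l..r}"
proof (rule ccontr)
  assume "K \<noteq> pt ` {l..r}"
  then obtain p where p: "p \<in> K" "p \<notin> pt ` {l..r}" using sub by blast
  then obtain n where "p = pt n" using K by (auto simp: Int_ZZ_def ZZ_eq)
  then have n: "pt n \<in> K" "n \<notin> {l..r}" using p by auto
  have lr: "pt l \<in> K" "pt r \<in> K" using sub assms(2) by auto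
  show False
  proof (cases "n < l")
    case True
    then show False using Int_ZZ_between[OF K n(1) lr(1), of "l - 1"] assms by auto
  next
    case False
    then show False using Int_ZZ_between[OF K lr(2) n(1), of "r + 1"] assms n by auto
  qed
qed

section \<open>Free vector spaces and linear extensions\<close>

definition delta :: "'a \<Rightarrow> 'a \<Rightarrow> 'k::zero_neq_one" where
  "delta u = (\<lambda>x. if x = u then 1 else 0)"

lemma delta_in_free_vs [simp]: "delta u \<in> carrier (free_vs X) \<longleftrightarrow> u \<in> X"
  by (auto simp: delta_def free_vs_def)

lemma free_vs_expansion:
  assumes "finite X" "f \<in> carrier (free_vs X)"
  shows "f = (\<lambda>x. \<Sum>u\<in>X. f u * delta u x)"
proof
  fix x
  have "(\<Sum>u\<in>X. f u * delta u x) = (\<Sum>u\<in>X. if u = x then f x else 0)"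
    by (intro sum.cong) (auto simp: delta_def)
  then show "f x = (\<Sum>u\<in>X. f u * delta u x)" using assms by (auto simp: carrier_free_vs)
qed

lemma free_map_eq:
  assumes "finite X" "f \<in> carrier (free_vs X)"
  shows "free_map \<phi> f = (\<lambda>y. \<Sum>x | x \<in> X \<and> \<phi> x = y. f x)"
  unfolding free_map_def
  using assms by (intro ext sum.mono_neutral_left) (auto simp: carrier_free_vs)

lemma free_map_closed:
  assumes "finite X" "finite Y" "\<phi> \<in> X \<rightarrow> Y" "f \<in> carrier (free_vs X)"
  shows "free_map \<phi> f \<in> carrier (free_vs Y)"
  using assms by (auto simp: free_map_eq carrier_free_vs intro!: sum.neutral)

lemma free_map_delta:
  assumes "finite X" "u \<in> X"
  shows "free_map \<phi> (delta u :: 'a \<Rightarrow> 'k::field) = delta (\<phi> u)"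
proof
  fix y
  have "free_map \<phi> (delta u :: 'a \<Rightarrow> 'k) y = (\<Sum>x | x \<in> X \<and> \<phi> x = y. delta u x)"
    using assms by (subst free_map_eq[of X]) auto
  also have "\<dots> = delta (\<phi> u) y" using assms by (simp add: delta_def)
  finally show "free_map \<phi> (delta u :: 'a \<Rightarrow> 'k) y = delta (\<phi> u) y" .
qed

lemma free_map_add:
  assumes "finite X" "f \<in> carrier (free_vs X)" "g \<in> carrier (free_vs X)"
  shows "free_map \<phi> (\<lambda>x. f x + g x) = (\<lambda>y. free_map \<phi> f y + free_map \<phi> g y)"
  using assms by (subst (1 2 3) free_map_eq[of X]) (auto simp: carrier_free_vs sum.distrib)

lemma free_map_diff:
  assumes "finite X" "f \<in> carrier (free_vs X)" "g \<in> carrier (free_vs X)"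
  shows "free_map \<phi> (\<lambda>x. f x - g x) = (\<lambda>y. free_map \<phi> f y - free_map \<phi> g y)"
  using assms by (subst (1 2 3) free_map_eq[of X]) (auto simp: carrier_free_vs sum_subtractf)

lemma free_map_sum:
  assumes "finite X" "\<And>c. c \<in> C \<Longrightarrow> f c \<in> carrier (free_vs X)"
  shows "free_map \<phi> (\<lambda>x. \<Sum>c\<in>C. a c * f c x) = (\<lambda>y. \<Sum>c\<in>C. a c * free_map \<phi> (f c) y)"
proof -
  have "(\<lambda>x. \<Sum>c\<in>C. a c * f c x) \<in> carrier (free_vs X)"
    using assms by (auto simp: carrier_free_vs intro!: sum.neutral)
  then have "free_map \<phi> (\<lambda>x. \<Sum>c\<in>C. a c * f c x) =
      (\<lambda>y. \<Sum>x | x \<in> X \<and> \<phi> x = y. \<Sum>c\<in>C. a c * f c x)"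
    using assms by (subst free_map_eq[of X]) auto
  also have "\<dots> = (\<lambda>y. \<Sum>c\<in>C. a c * (\<Sum>x | x \<in> X \<and> \<phi> x = y. f c x))"
    unfolding sum_distrib_left by (intro ext sum.swap)
  also have "\<dots> = (\<lambda>y. \<Sum>c\<in>C. a c * free_map \<phi> (f c) y)"
    using assms by (simp add: free_map_eq[of X])
  finally show ?thesis .
qed

section \<open>Components of a diagram and totals over them\<close>

lemma glue_sym: "(x, y) \<in> glue M J \<Longrightarrow> (y, x) \<in> glue M J"
  unfolding glue_def
  by (rule symD[OF sym_rtrancl]) (auto simp: sym_def)

lemma glue_refl [simp]: "(x, x) \<in> glue M J"
  by (simp add: glue_def)

lemma glue_trans: "(x, y) \<in> glue M J \<Longrightarrow> (y, z) \<in> glue M J \<Longrightarrow> (x, z) \<in> glue M J"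
  by (simp add: glue_def)

lemma set_colim_in_eq_iff:
  "set_colim_in M J p u = set_colim_in M J q v \<longleftrightarrow> ((p, u), (q, v)) \<in> glue M J"
  unfolding set_colim_in_def by (blast intro: glue_sym glue_trans glue_refl)

lemma set_colim_eq: "set_colim M J = {set_colim_in M J p u | p u. p \<in> J \<and> u \<in> Ob M p}"
  by (auto simp: set_colim_def quotient_def set_colim_in_def)

definition full_comps :: "'a set_diagram \<Rightarrow> point set \<Rightarrow> (point \<times> 'a) set set" where
  "full_comps M J = {c \<in> set_colim M J. supp M J c = J}"

lemma full_compsD:
  assumes "c \<in> full_comps M J" "p \<in> J"
  obtains u where "u \<in> Ob M p" "set_colim_in M J p u = c"
proof -
  from assms have "p \<in> supp M J c" by (simp add: full_comps_def)
  then show thesis using that by (auto simp: supp_def)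
qed

text \<open>The coefficient at \<open>c\<close> of the image of \<open>f\<close> in the colimit,
  when the colimit is identified with the free space on the components.\<close>

definition tot :: "'a set_diagram \<Rightarrow> point set \<Rightarrow> point \<Rightarrow> ('a \<Rightarrow> 'k) \<Rightarrow> (point \<times> 'a) set \<Rightarrow> 'k::field" where
  "tot M J p f c = (\<Sum>u | u \<in> Ob M p \<and> set_colim_in M J p u = c. f u)"

locale finite_sets_on_ZZ =
  fixes M :: "'a set_diagram"
  assumes finset: "finset_functor M"
begin

lemma finite_Ob [simp]: "p \<in> ZZ \<Longrightarrow> finite (Ob M p)"
  using finset by (simp add: finset_functor_def)

lemma Ar_closed [simp]: "p \<in> ZZ \<Longrightarrow> q \<in> ZZ \<Longrightarrow> p \<preceq> q \<Longrightarrow> u \<in> Ob M p \<Longrightarrow> Ar M p q u \<in> Ob M q"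
  using finset by (fastforce simp: finset_functor_def)

lemma Ar_id [simp]: "p \<in> ZZ \<Longrightarrow> u \<in> Ob M p \<Longrightarrow> Ar M p p u = u"
  using finset by (fastforce simp: finset_functor_def)

text \<open>An arrow of the category of elements over two consecutive points, with its ends listed
  from left to right whatever its direction. It starts at the end with the odd number, which is the
  minimal one.\<close>

definition edge :: "int \<Rightarrow> 'a \<Rightarrow> 'a \<Rightarrow> bool" where
  "edge n u v \<longleftrightarrow> (if odd n then u \<in> Ob M (pt n) \<and> v = Ar M (pt n) (pt (n + 1)) u
     else v \<in> Ob M (pt (n + 1)) \<and> u = Ar M (pt (n + 1)) (pt n) v)"

lemma edge_Ob: "edge n u v \<Longrightarrow> u \<in> Ob M (pt n) \<and> v \<in> Ob M (pt (n + 1))"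
  by (auto simp: edge_def pt_le_iff split: if_splits)

text \<open>Comparable points are equal or consecutive, and over equal points the arrow is the
  identity; so a walk only ever crosses an \<open>edge\<close>. The cases \<open>right\<close> and
  \<open>left\<close> refer to the direction of travel, not to that of the arrow.\<close>

lemma glue_induct [consumes 2, case_names base right left]:
  assumes "((pt m, u), x) \<in> glue M (pt ` {l..r})" "u \<in> Ob M (pt m)"
    and base: "P m u"
    and right: "\<And>n u v. n \<in> {l..r} \<Longrightarrow> n + 1 \<in> {l..r} \<Longrightarrow> edge n u v \<Longrightarrow> P n u \<Longrightarrow> P (n + 1) v"
    and left: "\<And>n u v. n \<in> {l..r} \<Longrightarrow> n + 1 \<in> {l..r} \<Longrightarrow> edge n u v \<Longrightarrow> P (n + 1) v \<Longrightarrow> P n u"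
  shows "\<exists>k w. x = (pt k, w) \<and> w \<in> Ob M (pt k) \<and> P k w"
  using assms(1) unfolding glue_def
proof (induction rule: rtrancl_induct)
  case base
  then show ?case using assms(2,3) by auto
next
  case (step y z)
  from step.IH obtain k w where y: "y = (pt k, w)" and w: "w \<in> Ob M (pt k)" "P k w" by auto
  from step.hyps(2) y obtain k' w' where z: "z = (pt k', w')" and k: "k \<in> {l..r}" "k' \<in> {l..r}"
    and or: "(pt k \<preceq> pt k' \<and> w' = Ar M (pt k) (pt k') w) \<or>
      (pt k' \<preceq> pt k \<and> w' \<in> Ob M (pt k') \<and> w = Ar M (pt k') (pt k) w')"
    by (auto simp: glue_step_def)
  have w': "w' \<in> Ob M (pt k')" using or w by auto
  consider "k' = k" "w' = w" | "k' = k + 1" "edge k w w'" | "k = k' + 1" "edge k' w' w"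
    using or w w' by (auto simp: pt_le_iff edge_def)
  then have "P k' w'"
    using w k right[of k w w'] left[of k' w' w] by cases auto
  then show ?case using z w' by blast
qed

text \<open>An element and its image lie in the same component, so the linear extension merely
  regroups the summands belonging to \<open>c\<close>.\<close>

lemma tot_free_map:
  assumes pq: "p \<in> J" "q \<in> J" "p \<preceq> q" and J: "J \<subseteq> ZZ" and f: "f \<in> carrier (free_vs (Ob M p))"
  shows "tot M J q (free_map (Ar M p q) f) c = tot M J p f c"
proof -
  have ZZ: "p \<in> ZZ" "q \<in> ZZ" using pq J by auto
  have cls: "set_colim_in M J q (Ar M p q u) = set_colim_in M J p u" if "u \<in> Ob M p" for u
  proof -
    have "((p, u), (q, Ar M p q u)) \<in> glue_step M J" using that pq by (auto simp: glue_step_def)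
    then have "((p, u), (q, Ar M p q u)) \<in> glue M J"
      unfolding glue_def by (intro r_into_rtrancl) simp
    then show ?thesis unfolding set_colim_in_eq_iff by (rule glue_sym)
  qed
  have "tot M J q (free_map (Ar M p q) f) c =
      (\<Sum>w | w \<in> Ob M q \<and> set_colim_in M J q w = c. \<Sum>u | u \<in> Ob M p \<and> Ar M p q u = w. f u)"
    unfolding tot_def using ZZ f by (subst free_map_eq[of "Ob M p"]) auto
  also have "\<dots> = (\<Sum>w | w \<in> Ob M q \<and> set_colim_in M J q w = c.
      \<Sum>u | u \<in> {u \<in> Ob M p. set_colim_in M J p u = c} \<and> Ar M p q u = w. f u)"
    using cls by (intro sum.cong refl) auto
  also have "\<dots> = tot M J p f c"
    unfolding tot_def using ZZ pq cls by (intro sum.group) auto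
  finally show ?thesis .
qed

end

section \<open>Sections and full components\<close>

text \<open>The inverse of \<open>pt\<close>, since the two halves of \<open>n\<close> add up to
  \<open>n\<close>. It turns families indexed by integers into families indexed by points.\<close>

definition pos :: "point \<Rightarrow> int" where "pos p = fst p + snd p"

lemma pos_pt [simp]: "pos (pt n) = n"
  unfolding pos_def pt_def fst_conv snd_conv by presburger

lemma free_map_id:
  assumes "finite X" "f \<in> carrier (free_vs X)" "\<And>x. x \<in> X \<Longrightarrow> \<phi> x = x"
  shows "free_map \<phi> f = f"
proof
  fix y
  have "free_map \<phi> f y = (\<Sum>x | x \<in> X \<and> x = y. f x)"
    using assms by (subst free_map_eq[of X]) (auto intro!: sum.cong)
  also have "\<dots> = f y"
    using assms by (cases "y \<in> X") (auto simp: carrier_free_vs Collect_conv_if conj_commute cong: conj_cong)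
  finally show "free_map \<phi> f y = f y" .
qed

text \<open>If \<open>c\<close> is no component at all, every point of \<open>J\<close> is missed.
  Admitting arbitrary \<open>c\<close> allows totals to be treated as functions on all sets that
  vanish off the full components.\<close>

lemma not_full_comps:
  assumes "c \<notin> full_comps M J" "J \<noteq> {}"
  obtains q where "q \<in> J" "\<And>u. u \<in> Ob M q \<Longrightarrow> set_colim_in M J q u \<noteq> c"
proof (cases "c \<in> set_colim M J")
  case True
  then have "supp M J c \<noteq> J" using assms by (simp add: full_comps_def)
  then show ?thesis using that by (auto simp: supp_def)
next
  case False
  obtain q where "q \<in> J" using assms(2) by blast
  moreover have "set_colim_in M J q u \<noteq> c" if "u \<in> Ob M q" for u
    using False that \<open>q \<in> J\<close> unfolding set_colim_eq by blast
  ultimately show ?thesis using that by blast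
qed

context finite_sets_on_ZZ
begin

text \<open>The elements of the limit with free values off \<open>J\<close>, so that families
  defined at all points qualify without restriction.\<close>

definition sections :: "point set \<Rightarrow> (point \<Rightarrow> 'a \<Rightarrow> 'k::field) set" where
  "sections J = {x. (\<forall>p\<in>J. x p \<in> carrier (free_vs (Ob M p))) \<and>
     (\<forall>p\<in>J. \<forall>q\<in>J. p \<preceq> q \<longrightarrow> free_map (Ar M p q) (x p) = x q)}"

definition vedge :: "int \<Rightarrow> ('a \<Rightarrow> 'k::field) \<Rightarrow> ('a \<Rightarrow> 'k) \<Rightarrow> bool" where
  "vedge n f g \<longleftrightarrow> (if odd n then free_map (Ar M (pt n) (pt (n + 1))) f = g
     else free_map (Ar M (pt (n + 1)) (pt n)) g = f)"

lemma vedge_delta: "edge n u v \<Longrightarrow> vedge n (delta u) (delta v :: 'a \<Rightarrow> 'k::field)"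
  using free_map_delta[of "Ob M (pt n)" u, where 'b = 'a and 'k = 'k]
    free_map_delta[of "Ob M (pt (n + 1))" v, where 'b = 'a and 'k = 'k]
  by (auto simp: edge_def vedge_def split: if_splits)

lemma
  fixes f g :: "'a \<Rightarrow> 'k::field"
  assumes "vedge n f g" "edge n u v" "f \<in> carrier (free_vs (Ob M (pt n)))"
    "g \<in> carrier (free_vs (Ob M (pt (n + 1))))"
  shows vedge_add_delta: "vedge n (\<lambda>x. f x + delta u x) (\<lambda>x. g x + delta v x)"
    and vedge_diff_delta: "vedge n (\<lambda>x. f x - delta u x) (\<lambda>x. g x - delta v x)"
proof -
  have uv: "delta u \<in> carrier (free_vs (Ob M (pt n)))" "delta v \<in> carrier (free_vs (Ob M (pt (n + 1))))"
    using edge_Ob[OF assms(2)] by auto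
  note vd = vedge_delta[OF assms(2), where 'k = 'k]
  show "vedge n (\<lambda>x. f x + delta u x) (\<lambda>x. g x + delta v x)"
    using assms(1) vd
    by (simp add: vedge_def free_map_add[OF _ assms(3) uv(1)] free_map_add[OF _ assms(4) uv(2)]
        split: if_splits)
  show "vedge n (\<lambda>x. f x - delta u x) (\<lambda>x. g x - delta v x)"
    using assms(1) vd
    by (simp add: vedge_def free_map_diff[OF _ assms(3) uv(1)] free_map_diff[OF _ assms(4) uv(2)]
        split: if_splits)
qed

lemma sectionsI:
  assumes "\<And>n. n \<in> {l..r} \<Longrightarrow> y n \<in> carrier (free_vs (Ob M (pt n)))"
    and "\<And>n. l \<le> n \<Longrightarrow> n < r \<Longrightarrow> vedge n (y n) (y (n + 1))"
  shows "(\<lambda>p. y (pos p)) \<in> sections (pt ` {l..r})"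
proof -
  have "free_map (Ar M (pt m) (pt n)) (y m) = y n" if "m \<in> {l..r}" "n \<in> {l..r}" "pt m \<preceq> pt n" for m n
  proof -
    have "n = m \<or> odd m \<and> n = m + 1 \<or> even n \<and> m = n + 1"
      using that(3) unfolding pt_le_iff by presburger
    then consider "n = m" | "odd m" "n = m + 1" | "even n" "m = n + 1" by blast
    then show ?thesis
    proof cases
      case 1
      then show ?thesis using assms(1) that free_map_id[of "Ob M (pt m)" "y m"] by simp
    next
      case 2
      then show ?thesis using assms(2)[of m] that by (simp add: vedge_def)
    next
      case 3
      then show ?thesis using assms(2)[of n] that by (simp add: vedge_def)
    qed
  qed
  then show ?thesis using assms(1) by (auto simp: sections_def pos_pt)
qed

text \<open>A walk in the category of elements from \<open>u0\<close> to the right end carries a unit of flow. Left of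
  the current position the family is compatible; to the right it is compatible after the unit has been
  taken away from the current element.\<close>

lemma ex_section:
  assumes "l \<le> r" and u0: "u0 \<in> Ob M (pt l)"
    and "((pt l, u0), (pt r, u1)) \<in> glue M (pt ` {l..r})"
  shows "\<exists>x\<in>sections (pt ` {l..r}). x (pt l) = (delta u0 :: 'a \<Rightarrow> 'k::field)"
proof -
  \<comment> \<open>The walk stands at \<open>u\<close> over the point numbered \<open>p\<close>.
    For \<open>p = r\<close> the last clause is vacuous, and \<open>y\<close> is then a
    section.\<close>
  define P where "P p u \<longleftrightarrow> (\<exists>y :: int \<Rightarrow> 'a \<Rightarrow> 'k.
      (\<forall>n\<in>{l..r}. y n \<in> carrier (free_vs (Ob M (pt n)))) \<and> y l = delta u0 \<and>
      (\<forall>n. l \<le> n \<and> n < p \<longrightarrow> vedge n (y n) (y (n + 1))) \<and>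
      (\<forall>n. p \<le> n \<and> n < r \<longrightarrow> vedge n ((y(p := \<lambda>x. y p x - delta u x)) n) (y (n + 1))))" for p u
  have closed: "(\<lambda>x. f x + delta u x) \<in> carrier (free_vs X)" "(\<lambda>x. f x - delta u x) \<in> carrier (free_vs X)"
    if "f \<in> carrier (free_vs X)" "u \<in> X" "finite X" for f :: "'a \<Rightarrow> 'k" and u X
    using that by (auto simp: carrier_free_vs delta_def)
  have vedge0: "vedge n (\<lambda>x. 0) (\<lambda>x. 0 :: 'k)" for n
    by (simp add: vedge_def free_map_def)
  have "\<exists>k w. (pt r, u1) = (pt k, w) \<and> w \<in> Ob M (pt k) \<and> P k w"
    using assms(3) u0
  proof (induction rule: glue_induct)
    case base
    \<comment> \<open>At the start, taking away the unit leaves 0 at \<open>l\<close>, which is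
      compatible with the zero family to its right.\<close>
    show ?case unfolding P_def
      using u0 vedge0 by (intro exI[of _ "\<lambda>n. if n = l then delta u0 else (\<lambda>x. 0)"]) (auto simp: free_vs_def delta_def)
  next
    case (right n u v)
    then obtain y :: "int \<Rightarrow> 'a \<Rightarrow> 'k" where y: "\<And>n. n \<in> {l..r} \<Longrightarrow> y n \<in> carrier (free_vs (Ob M (pt n)))"
        "y l = delta u0" "\<And>m. l \<le> m \<Longrightarrow> m < n \<Longrightarrow> vedge m (y m) (y (m + 1))"
        "\<And>m. n \<le> m \<Longrightarrow> m < r \<Longrightarrow> vedge m ((y(n := \<lambda>x. y n x - delta u x)) m) (y (m + 1))"
      unfolding P_def by blast
    \<comment> \<open>Adding the edge to the compatible pair at \<open>n\<close> repairs it. The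
      unit added at \<open>n + 1\<close> is the one the invariant takes away there, so the pairs
      further right are unaffected.\<close>
    define y' where "y' = y(n + 1 := \<lambda>x. y (n + 1) x + delta v x)"
    have uv: "u \<in> Ob M (pt n)" "v \<in> Ob M (pt (n + 1))" using edge_Ob[OF right(3)] by auto
    have "vedge n (y n) (y' (n + 1))"
    proof -
      have "vedge n (\<lambda>x. y n x - delta u x) (y (n + 1))" using y(4)[of n] right by auto
      from vedge_add_delta[OF this right(3)] show ?thesis
        using closed y(1) uv right by (simp add: y'_def)
    qed
    then have "vedge m (y' m) (y' (m + 1))" if "l \<le> m" "m < n + 1" for m
      using y(3)[of m] that by (cases "m = n") (auto simp: y'_def)
    moreover have "vedge m ((y'(n + 1 := \<lambda>x. y' (n + 1) x - delta v x)) m) (y' (m + 1))"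
      if "n + 1 \<le> m" "m < r" for m
      using y(4)[of m] that by (auto simp: y'_def)
    ultimately show ?case unfolding P_def
      using y(1,2) right closed uv by (intro exI[of _ y']) (auto simp: y'_def)
  next
    case (left n u v)
    then obtain y :: "int \<Rightarrow> 'a \<Rightarrow> 'k" where y: "\<And>n. n \<in> {l..r} \<Longrightarrow> y n \<in> carrier (free_vs (Ob M (pt n)))"
        "y l = delta u0" "\<And>m. l \<le> m \<Longrightarrow> m < n + 1 \<Longrightarrow> vedge m (y m) (y (m + 1))"
        "\<And>m. n + 1 \<le> m \<Longrightarrow> m < r \<Longrightarrow>
          vedge m ((y(n + 1 := \<lambda>x. y (n + 1) x - delta v x)) m) (y (m + 1))"
      unfolding P_def by blast
    \<comment> \<open>The edge is now subtracted from a compatible pair. In both directions only the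
      right end of the edge changes, so the value at \<open>l\<close> remains
      \<open>delta u0\<close> even if the walk returns to \<open>l\<close>.\<close>
    define y' where "y' = y(n + 1 := \<lambda>x. y (n + 1) x - delta v x)"
    have uv: "u \<in> Ob M (pt n)" "v \<in> Ob M (pt (n + 1))" using edge_Ob[OF left(3)] by auto
    have "vedge n (\<lambda>x. y n x - delta u x) (y' (n + 1))"
      using vedge_diff_delta[OF _ left(3), of "y n" "y (n + 1)"] y(1,3) left by (simp add: y'_def)
    then have "vedge m ((y'(n := \<lambda>x. y' n x - delta u x)) m) (y' (m + 1))"
      if "n \<le> m" "m < r" for m
      using y(4)[of m] that by (cases "m = n") (auto simp: y'_def)
    moreover have "vedge m (y' m) (y' (m + 1))" if "l \<le> m" "m < n" for m
      using y(3)[of m] that by (auto simp: y'_def)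
    ultimately show ?case unfolding P_def
      using y(1,2) left closed uv by (intro exI[of _ y']) (auto simp: y'_def)
  qed
  then have "P r u1" by auto
  then obtain y :: "int \<Rightarrow> 'a \<Rightarrow> 'k" where "\<And>n. n \<in> {l..r} \<Longrightarrow> y n \<in> carrier (free_vs (Ob M (pt n)))"
      "y l = delta u0" "\<And>n. l \<le> n \<Longrightarrow> n < r \<Longrightarrow> vedge n (y n) (y (n + 1))"
    unfolding P_def by blast
  then show ?thesis
    using sectionsI[of l r y] by (intro bexI[of _ "\<lambda>p. y (pos p)"]) (auto simp: pos_pt)
qed

lemma tot_delta:
  assumes "p \<in> ZZ" "u \<in> Ob M p"
  shows "tot M J p (delta u) c = (if set_colim_in M J p u = c then 1 else 0)"
proof -
  have "tot M J p (delta u) c = (\<Sum>v | v \<in> Ob M p \<and> set_colim_in M J p v = c. if v = u then 1 else 0)"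
    by (simp add: tot_def delta_def)
  then show ?thesis using assms by simp
qed

lemma tot_section:
  assumes "x \<in> sections (pt ` {l..r})" "p \<in> pt ` {l..r}" "q \<in> pt ` {l..r}"
  shows "tot M (pt ` {l..r}) p (x p) c = tot M (pt ` {l..r}) q (x q) c"
proof -
  let ?J = "pt ` {l..r}"
  have le: "tot M ?J p (x p) c = tot M ?J q (x q) c" if "p \<in> ?J" "q \<in> ?J" "p \<preceq> q" for p q
  proof -
    have "tot M ?J q (free_map (Ar M p q) (x p)) c = tot M ?J p (x p) c"
      using that assms(1) by (intro tot_free_map) (auto simp: sections_def)
    moreover have "free_map (Ar M p q) (x p) = x q"
      using that assms(1) unfolding sections_def by blast
    ultimately show ?thesis by simp
  qed
  have base: "tot M ?J (pt n) (x (pt n)) c = tot M ?J (pt l) (x (pt l)) c" if "l \<le> n" "n \<le> r" for n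
    using that
  proof (induction n rule: int_ge_induct)
    case (step n)
    have "pt n \<preceq> pt (n + 1) \<or> pt (n + 1) \<preceq> pt n" by (simp add: pt_le_iff)
    then show ?case using le[of "pt n" "pt (n + 1)"] le[of "pt (n + 1)" "pt n"] step by auto
  qed simp
  have "tot M ?J p (x p) c = tot M ?J (pt l) (x (pt l)) c" if "p \<in> ?J" for p
  proof -
    from that obtain n where "p = pt n" "l \<le> n" "n \<le> r" by auto
    then show ?thesis using base[of n] by blast
  qed
  then show ?thesis using assms(2,3) by metis
qed

text \<open>The total over \<open>c\<close> is the same at all points of the interval, and at a
  point that \<open>c\<close> misses it is an empty sum.\<close>

lemma tot_section_not_full:
  assumes "x \<in> sections (pt ` {l..r})" "p \<in> pt ` {l..r}" "c \<notin> full_comps M (pt ` {l..r})"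
  shows "tot M (pt ` {l..r}) p (x p) c = 0"
proof -
  obtain q where q: "q \<in> pt ` {l..r}"
      "\<And>u. u \<in> Ob M q \<Longrightarrow> set_colim_in M (pt ` {l..r}) q u \<noteq> c"
    using not_full_comps[OF assms(3)] assms(2) by blast
  have "tot M (pt ` {l..r}) q (x q) c = 0"
    unfolding tot_def by (rule sum.neutral) (use q in auto)
  then show ?thesis using tot_section[OF assms(1,2) q(1)] by simp
qed

text \<open>Fullness supplies elements of \<open>c\<close> over both ends, and being in one
  component they are joined by a walk.\<close>

lemma ex_section_full:
  assumes "c \<in> full_comps M (pt ` {l..r})" "l \<le> r"
  shows "\<exists>u x. u \<in> Ob M (pt l) \<and> set_colim_in M (pt ` {l..r}) (pt l) u = c \<and>
    x \<in> sections (pt ` {l..r}) \<and> x (pt l) = (delta u :: 'a \<Rightarrow> 'k::field)"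
proof -
  obtain u where u: "u \<in> Ob M (pt l)" "set_colim_in M (pt ` {l..r}) (pt l) u = c"
    using full_compsD[OF assms(1), of "pt l"] assms(2) by auto
  obtain v where v: "set_colim_in M (pt ` {l..r}) (pt r) v = c"
    using full_compsD[OF assms(1), of "pt r"] assms(2) by auto
  have "((pt l, u), (pt r, v)) \<in> glue M (pt ` {l..r})"
    using u v by (simp flip: set_colim_in_eq_iff)
  then show ?thesis using ex_section[OF assms(2) u(1)] u by blast
qed

lemma finite_full_comps: "finite (full_comps M (pt ` {l..r}))"
proof -
  have "set_colim M (pt ` {l..r}) \<subseteq>
      (\<lambda>(p, u). set_colim_in M (pt ` {l..r}) p u) ` (SIGMA p:pt ` {l..r}. Ob M p)"
    by (auto simp: set_colim_eq)
  moreover have "finite (SIGMA p:pt ` {l..r}. Ob M p)" by auto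
  ultimately show ?thesis
    by (auto simp: full_comps_def intro: finite_subset[OF _ finite_imageI])
qed

end

section \<open>The rank invariant\<close>

lemma tot_add: "tot M J p (\<lambda>x. f x + g x) c = tot M J p f c + tot M J p g c"
  by (simp add: tot_def sum.distrib)

lemma tot_diff: "tot M J p (\<lambda>x. f x - g x) c = tot M J p f c - tot M J p g c"
  by (simp add: tot_def sum_subtractf)

lemma tot_mult: "tot M J p (\<lambda>x. a * f x) c = a * tot M J p f c"
  by (simp add: tot_def sum_distrib_left)

lemma tot_zero: "tot M J p (\<lambda>x. 0) c = 0"
  by (simp add: tot_def)

lemma tot_sum: "tot M J p (\<lambda>x. \<Sum>d\<in>C. a d * f d x) c = (\<Sum>d\<in>C. a d * tot M J p (f d) c)"
  unfolding tot_def sum_distrib_left by (rule sum.swap)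

text \<open>The linear map from the direct sum to functions on components whose kernel will turn out
  to be \<open>vec_glue\<close>.\<close>

definition ctotal :: "'a set_diagram \<Rightarrow> point set \<Rightarrow> (point \<Rightarrow> 'a \<Rightarrow> 'k::field) \<Rightarrow> (point \<times> 'a) set \<Rightarrow> 'k" where
  "ctotal M J y c = (\<Sum>p\<in>J. tot M J p (y p) c)"

abbreviation dsum_free :: "'a set_diagram \<Rightarrow> point set \<Rightarrow> ('k::field, point \<Rightarrow> 'a \<Rightarrow> 'k) module" where
  "dsum_free M J \<equiv> vs_dsum J (Ob (free_diagram M))"

text \<open>Differences of two basis vectors of the direct sum. Those with both ends in one
  component span the kernel of \<open>ctotal\<close>.\<close>

definition dipole :: "point set \<Rightarrow> point \<Rightarrow> 'a \<Rightarrow> point \<Rightarrow> 'a \<Rightarrow> point \<Rightarrow> 'a \<Rightarrow> 'k::field" where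
  "dipole J p u q v = (\<lambda>i\<in>J. \<lambda>x. (if i = p then delta u x else 0) - (if i = q then delta v x else 0))"

lemma vs_prod_simps:
  "\<zero>\<^bsub>vs_prod A V\<^esub> = (\<lambda>i\<in>A. \<zero>\<^bsub>V i\<^esub>)"
  "y \<oplus>\<^bsub>vs_prod A V\<^esub> z = (\<lambda>i\<in>A. y i \<oplus>\<^bsub>V i\<^esub> z i)"
  "a \<odot>\<^bsub>vs_prod A V\<^esub> y = (\<lambda>i\<in>A. a \<odot>\<^bsub>V i\<^esub> y i)"
  by (simp_all add: vs_prod_def)

lemma ctotal_restrict: "ctotal M J (restrict y J) c = ctotal M J y c"
  by (simp add: ctotal_def)

lemma
  assumes J: "finite J"
  shows carrier_dsum_free: "y \<in> carrier (dsum_free M J) \<longleftrightarrow>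
      y \<in> extensional J \<and> (\<forall>p\<in>J. y p \<in> carrier (free_vs (Ob M p)))"
    and dsum_free_zero: "\<zero>\<^bsub>dsum_free M J\<^esub> = (\<lambda>i\<in>J. \<lambda>x. 0)"
    and dsum_free_add: "y \<oplus>\<^bsub>dsum_free M J\<^esub> z = (\<lambda>i\<in>J. \<lambda>x. y i x + z i x)"
    and dsum_free_smult: "a \<odot>\<^bsub>dsum_free M J\<^esub> y = (\<lambda>i\<in>J. \<lambda>x. a * y i x)"
  by (auto simp: vs_dsum_finite[OF J] vs_prod_simps free_diagram_def)
     (auto simp: vs_prod_def PiE_def free_diagram_def)

lemma module_dsum_free:
  "finite J \<Longrightarrow> module class_ring (dsum_free M J :: ('k::field, point \<Rightarrow> 'a \<Rightarrow> 'k) module)"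
  by (simp add: vs_dsum_finite free_diagram_def module_vs_prod module_free_vs)

lemma dsum_free_minus:
  fixes y z :: "point \<Rightarrow> 'a \<Rightarrow> 'k::field"
  assumes J: "finite J" and yz: "y \<in> carrier (dsum_free M J)" "z \<in> carrier (dsum_free M J)"
  shows "y \<ominus>\<^bsub>dsum_free M J\<^esub> z = (\<lambda>i\<in>J. \<lambda>x. y i x - z i x)"
proof -
  interpret Module.module class_ring "dsum_free M J :: ('k, point \<Rightarrow> 'a \<Rightarrow> 'k) module"
    by (rule module_dsum_free[OF J])
  have neg: "(\<lambda>i\<in>J. \<lambda>x. - z i x) \<in> carrier (dsum_free M J)"
    using yz(2) by (auto simp: carrier_dsum_free[OF J] free_vs_def)
  have "\<ominus>\<^bsub>dsum_free M J\<^esub> z = (\<lambda>i\<in>J. \<lambda>x. - z i x)"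
    by (rule minus_equality[OF _ yz(2) neg]) (auto simp: dsum_free_add[OF J] dsum_free_zero[OF J])
  then show ?thesis by (auto simp: a_minus_def dsum_free_add[OF J])
qed

lemma vs_quot_simps:
  "carrier (vs_quot V W) = a_rcosets\<^bsub>V\<^esub> W" "\<zero>\<^bsub>vs_quot V W\<^esub> = W"
  "A \<oplus>\<^bsub>vs_quot V W\<^esub> B = A <+>\<^bsub>V\<^esub> B"
  "c \<odot>\<^bsub>vs_quot V W\<^esub> A = (\<Union>a\<in>A. W +>\<^bsub>V\<^esub> (c \<odot>\<^bsub>V\<^esub> a))"
  by (simp_all add: vs_quot_def)

context finite_sets_on_ZZ
begin

context
  fixes l r :: int and J :: "point set"
  assumes lr: "l \<le> r" and J_eq: "J = pt ` {l..r}"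
begin

lemma finite_J: "finite J" by (simp add: J_eq)

lemma J_ZZ: "p \<in> J \<Longrightarrow> p \<in> ZZ" by (auto simp: J_eq)

lemmas dsum_free_simps = carrier_dsum_free[OF finite_J] dsum_free_zero[OF finite_J]
  dsum_free_add[OF finite_J] dsum_free_smult[OF finite_J]

lemma finite_Sigma_Ob: "finite (SIGMA p:J. Ob M p)"
  using finite_J finite_Ob[OF J_ZZ] by (rule finite_SigmaI)

lemma ctotal_Sigma:
  "ctotal M J y c = (\<Sum>(p, u) | p \<in> J \<and> u \<in> Ob M p \<and> set_colim_in M J p u = c. y p u)"
proof -
  have "ctotal M J y c = (\<Sum>(p, u)\<in>(SIGMA p:J. {u \<in> Ob M p. set_colim_in M J p u = c}). y p u)"
    unfolding ctotal_def tot_def using finite_J J_ZZ by (subst sum.Sigma) auto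
  also have "(SIGMA p:J. {u \<in> Ob M p. set_colim_in M J p u = c}) =
      {(p, u). p \<in> J \<and> u \<in> Ob M p \<and> set_colim_in M J p u = c}" by auto
  finally show ?thesis .
qed

lemma vs_dsum_in_free:
  "vs_dsum_in J (Ob (free_diagram M)) p f = (\<lambda>i\<in>J. if i = p then f else (\<lambda>x. 0))"
  by (simp add: vs_dsum_in_def free_diagram_def cong: if_cong)

lemma ctotal_vs_dsum_in:
  assumes "p \<in> J"
  shows "ctotal M J (vs_dsum_in J (Ob (free_diagram M)) p f) c = tot M J p f c"
proof -
  have "ctotal M J (vs_dsum_in J (Ob (free_diagram M)) p f) c =
      (\<Sum>i\<in>J. if i = p then tot M J p f c else 0)"
    unfolding ctotal_def
    by (intro sum.cong refl) (auto simp: vs_dsum_in_free tot_zero)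
  then show ?thesis using assms finite_J by simp
qed

lemma vs_dsum_in_closed:
  assumes "p \<in> J" "f \<in> carrier (free_vs (Ob M p))"
  shows "vs_dsum_in J (Ob (free_diagram M)) p f \<in> carrier (dsum_free M J)"
  unfolding vs_dsum_in_free using assms J_ZZ by (auto simp: dsum_free_simps carrier_free_vs)

section \<open>The gluing subspace as the kernel of the totals\<close>

lemma vec_glue_eq_generators:
  "vec_glue (free_diagram M) J = LinearCombinations.module.span class_ring (dsum_free M J)
     {\<lambda>i\<in>J. \<lambda>x. (if i = p then f x else 0) - (if i = q then free_map (Ar M p q) f x else (0::'k::field))
       | p q f. p \<in> J \<and> q \<in> J \<and> p \<preceq> q \<and> f \<in> carrier (free_vs (Ob M p))}"
    (is "_ = LinearCombinations.module.span _ _ ?S")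
proof -
  let ?G = "free_diagram M :: ('k, 'a \<Rightarrow> 'k) vec_diagram"
  have "vs_dsum_in J (Ob ?G) p f \<ominus>\<^bsub>dsum_free M J\<^esub> vs_dsum_in J (Ob ?G) q (Ar ?G p q f) =
     (\<lambda>i\<in>J. \<lambda>x. (if i = p then f x else 0) - (if i = q then free_map (Ar M p q) f x else 0))"
    if pq: "p \<in> J" "q \<in> J" "p \<preceq> q" and f: "f \<in> carrier (free_vs (Ob M p))" for p q and f :: "'a \<Rightarrow> 'k"
  proof -
    have "free_map (Ar M p q) f \<in> carrier (free_vs (Ob M q))"
      using pq f J_ZZ by (intro free_map_closed[of "Ob M p"]) auto
    then have "vs_dsum_in J (Ob ?G) p f \<ominus>\<^bsub>dsum_free M J\<^esub> vs_dsum_in J (Ob ?G) q (free_map (Ar M p q) f) =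
        (\<lambda>i\<in>J. \<lambda>x. vs_dsum_in J (Ob ?G) p f i x - vs_dsum_in J (Ob ?G) q (free_map (Ar M p q) f) i x)"
      using pq f by (intro dsum_free_minus[OF finite_J] vs_dsum_in_closed) auto
    moreover have "Ar ?G p q f = free_map (Ar M p q) f" by (simp add: free_diagram_def)
    ultimately show ?thesis by (auto simp: vs_dsum_in_free intro!: restrict_ext)
  qed
  note eq = this
  have Ob: "carrier (Ob ?G p) = carrier (free_vs (Ob M p))" for p by (simp add: free_diagram_def)
  have "{vs_dsum_in J (Ob ?G) p v \<ominus>\<^bsub>dsum_free M J\<^esub> vs_dsum_in J (Ob ?G) q (Ar ?G p q v) | p q v.
        p \<in> J \<and> q \<in> J \<and> p \<preceq> q \<and> v \<in> carrier (Ob ?G p)} = ?S"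
    unfolding Ob
  proof (intro Collect_cong ex_cong1)
    fix z :: "point \<Rightarrow> 'a \<Rightarrow> 'k" and p q :: point and f :: "'a \<Rightarrow> 'k"
    show "(z = vs_dsum_in J (Ob ?G) p f \<ominus>\<^bsub>dsum_free M J\<^esub> vs_dsum_in J (Ob ?G) q (Ar ?G p q f) \<and>
          p \<in> J \<and> q \<in> J \<and> p \<preceq> q \<and> f \<in> carrier (free_vs (Ob M p))) \<longleftrightarrow>
        (z = (\<lambda>i\<in>J. \<lambda>x. (if i = p then f x else 0) - (if i = q then free_map (Ar M p q) f x else 0)) \<and>
          p \<in> J \<and> q \<in> J \<and> p \<preceq> q \<and> f \<in> carrier (free_vs (Ob M p)))"
      using eq[of p q f] by (cases "p \<in> J \<and> q \<in> J \<and> p \<preceq> q \<and> f \<in> carrier (free_vs (Ob M p))", simp, blast)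
  qed
  then show ?thesis by (simp add: vec_glue_def)
qed

lemma vec_glue_generators_closed:
  assumes "p \<in> J" "q \<in> J" "p \<preceq> q" "f \<in> carrier (free_vs (Ob M p))"
  shows "(\<lambda>i\<in>J. \<lambda>x. (if i = p then f x else 0) - (if i = q then free_map (Ar M p q) f x else (0::'k::field)))
    \<in> carrier (dsum_free M J)"
proof -
  have "free_map (Ar M p q) f \<in> carrier (free_vs (Ob M q))"
    using assms J_ZZ by (intro free_map_closed[of "Ob M p"]) auto
  then show ?thesis using assms J_ZZ by (auto simp: dsum_free_simps carrier_free_vs)
qed

lemma generator_in_vec_glue:
  assumes "p \<in> J" "q \<in> J" "p \<preceq> q" "f \<in> carrier (free_vs (Ob M p))"
  shows "(\<lambda>i\<in>J. \<lambda>x. (if i = p then f x else 0) - (if i = q then free_map (Ar M p q) f x else (0::'k::field)))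
    \<in> vec_glue (free_diagram M) J"
  unfolding vec_glue_eq_generators
  by (rule subsetD[OF module.in_own_span[OF module_dsum_free[OF finite_J]]])
     (use assms vec_glue_generators_closed in blast)+

lemma ctotal_generator:
  assumes "p \<in> J" "q \<in> J" "p \<preceq> q" "f \<in> carrier (free_vs (Ob M p))"
  shows "ctotal M J (\<lambda>i\<in>J. \<lambda>x. (if i = p then f x else 0) -
    (if i = q then free_map (Ar M p q) f x else (0::'k::field))) c = 0"
proof -
  have "ctotal M J (\<lambda>i\<in>J. \<lambda>x. (if i = p then f x else 0) -
      (if i = q then free_map (Ar M p q) f x else 0)) c =
    (\<Sum>i\<in>J. (if i = p then tot M J p f c else 0) - (if i = q then tot M J q (free_map (Ar M p q) f) c else 0))"
    unfolding ctotal_def by (intro sum.cong refl) (auto simp: tot_diff tot_zero)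
  also have "\<dots> = tot M J p f c - tot M J q (free_map (Ar M p q) f) c"
    using assms finite_J by (simp add: sum_subtractf)
  also have "\<dots> = 0" using assms J_ZZ by (simp add: tot_free_map subset_iff)
  finally show ?thesis .
qed

text \<open>A single form for sums, differences and multiples, obtained with coefficients 1, -1 and
  0.\<close>

lemma ctotal_lincomb:
  "ctotal M J (\<lambda>i\<in>J. \<lambda>x. a * y i x + b * z i x) c = a * ctotal M J y c + b * ctotal M J z c"
  by (simp add: ctotal_def tot_add tot_mult sum.distrib sum_distrib_left)

lemma dsum_free_lincomb_closed:
  assumes "y \<in> carrier (dsum_free M J)" "z \<in> carrier (dsum_free M J)"
  shows "(\<lambda>i\<in>J. \<lambda>x. a * y i x + b * z i x :: 'k::field) \<in> carrier (dsum_free M J)"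
  unfolding dsum_free_simps
proof (intro conjI ballI)
  fix p assume p: "p \<in> J"
  have "y p \<in> carrier (free_vs (Ob M p))" "z p \<in> carrier (free_vs (Ob M p))"
    using assms p unfolding dsum_free_simps by blast+
  then show "(\<lambda>i\<in>J. \<lambda>x. a * y i x + b * z i x) p \<in> carrier (free_vs (Ob M p))"
    using p by (simp add: carrier_free_vs[OF finite_Ob[OF J_ZZ[OF p]]])
qed simp

lemma submodule_ker_ctotal:
  "submodule class_ring {y \<in> carrier (dsum_free M J). \<forall>c. ctotal M J y c = (0::'k::field)} (dsum_free M J)"
proof (rule submodule.intro)
  show "module class_ring (dsum_free M J :: ('k, point \<Rightarrow> 'a \<Rightarrow> 'k) module)"
    by (rule module_dsum_free[OF finite_J])
  let ?K = "{y \<in> carrier (dsum_free M J). \<forall>c. ctotal M J y c = (0::'k)}"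
  show "?K \<subseteq> carrier (dsum_free M J)" by blast
  show "v \<oplus>\<^bsub>dsum_free M J\<^esub> w \<in> ?K" if "v \<in> ?K" "w \<in> ?K" for v w
    using that dsum_free_lincomb_closed[of v w 1 1] ctotal_lincomb[of 1 v 1 w]
    by (simp add: dsum_free_simps(3))
  show "\<zero>\<^bsub>dsum_free M J\<^esub> \<in> ?K"
    by (simp add: dsum_free_simps ctotal_restrict ctotal_def tot_zero free_vs_def)
  show "a \<odot>\<^bsub>dsum_free M J\<^esub> v \<in> ?K" if "v \<in> ?K" for a v
    using that dsum_free_lincomb_closed[of v v a 0] ctotal_lincomb[of a v 0 v]
    by (simp add: dsum_free_simps(4))
qed

lemma submodule_vec_glue:
  "submodule class_ring (vec_glue (free_diagram M) J) (dsum_free M J :: ('k::field, point \<Rightarrow> 'a \<Rightarrow> 'k) module)"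
  unfolding vec_glue_eq_generators
  by (rule module.span_is_submodule[OF module_dsum_free[OF finite_J]])
     (use vec_glue_generators_closed in blast)

lemma vec_glue_subset_ker:
  "vec_glue (free_diagram M) J \<subseteq> {y \<in> carrier (dsum_free M J). \<forall>c. ctotal M J y c = (0::'k::field)}"
  unfolding vec_glue_eq_generators
  by (rule module.span_is_subset[OF module_dsum_free[OF finite_J] _ submodule_ker_ctotal])
     (use vec_glue_generators_closed ctotal_generator in blast)

lemma vec_glue_lincomb:
  assumes "y \<in> vec_glue (free_diagram M) J" "z \<in> vec_glue (free_diagram M) J"
  shows "(\<lambda>i\<in>J. \<lambda>x. a * y i x + b * z i x) \<in> vec_glue (free_diagram M :: ('k::field, 'a \<Rightarrow> 'k) vec_diagram) J"
proof -
  interpret submodule class_ring "vec_glue (free_diagram M) J" "dsum_free M J :: ('k, point \<Rightarrow> 'a \<Rightarrow> 'k) module"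
    by (rule submodule_vec_glue)
  have "(a \<odot>\<^bsub>dsum_free M J\<^esub> y) \<oplus>\<^bsub>dsum_free M J\<^esub> (b \<odot>\<^bsub>dsum_free M J\<^esub> z) \<in> vec_glue (free_diagram M) J"
    using assms by auto
  moreover have "(a \<odot>\<^bsub>dsum_free M J\<^esub> y) \<oplus>\<^bsub>dsum_free M J\<^esub> (b \<odot>\<^bsub>dsum_free M J\<^esub> z) =
      (\<lambda>i\<in>J. \<lambda>x. a * y i x + b * z i x)"
    by (auto simp: dsum_free_simps)
  ultimately show ?thesis by simp
qed

text \<open>Across one edge a dipole is a generator or the negative of one. Dipoles that share an
  end add up to the dipole of the outer ends, so every walk gives a dipole in
  \<open>vec_glue\<close>.\<close>

lemma dipole_in_vec_glue:
  assumes "p \<in> J" "u \<in> Ob M p" "((p, u), (q, v)) \<in> glue M J"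
  shows "dipole J p u q v \<in> vec_glue (free_diagram M :: ('k::field, 'a \<Rightarrow> 'k) vec_diagram) J"
proof -
  let ?W = "vec_glue (free_diagram M :: ('k, 'a \<Rightarrow> 'k) vec_diagram) J"
  interpret submodule class_ring ?W "dsum_free M J :: ('k, point \<Rightarrow> 'a \<Rightarrow> 'k) module"
    by (rule submodule_vec_glue)
  have gen: "dipole J s w t (Ar M s t w) \<in> ?W" if "s \<in> J" "t \<in> J" "s \<preceq> t" "w \<in> Ob M s" for s t w
  proof -
    have "dipole J s w t (Ar M s t w) = (\<lambda>i\<in>J. \<lambda>x. (if i = s then (delta w :: 'a \<Rightarrow> 'k) x else 0) -
        (if i = t then free_map (Ar M s t) (delta w) x else 0))"
      unfolding dipole_def free_map_delta[OF finite_Ob[OF J_ZZ[OF that(1)]] that(4)] by simp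
    also have "\<dots> \<in> ?W"
      using that by (intro generator_in_vec_glue) simp_all
    finally show ?thesis .
  qed
  have comb: "dipole J s w t' w' \<in> ?W" if "dipole J s w t v \<in> ?W" "dipole J t v t' w' \<in> ?W" for s w t v t' w'
  proof -
    have "dipole J s w t' w' =
        (\<lambda>i\<in>J. \<lambda>x. 1 * (dipole J s w t v i x :: 'k) + 1 * dipole J t v t' w' i x)"
      by (auto simp: dipole_def)
    then show ?thesis using vec_glue_lincomb[OF that, of 1 1] by simp
  qed
  have rev: "dipole J t v s w \<in> ?W" if "dipole J s w t v \<in> ?W" for s w t v
  proof -
    have "dipole J t v s w = (\<lambda>i\<in>J. \<lambda>x. (- 1) * (dipole J s w t v i x :: 'k) + 0 * dipole J s w t v i x)"
      by (auto simp: dipole_def)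
    then show ?thesis using vec_glue_lincomb[OF that that, of "- 1" 0] by simp
  qed
  obtain m where m: "p = pt m" using assms(1) J_eq by auto
  have e: "dipole J (pt n) w (pt (n + 1)) w' \<in> ?W" if "n \<in> {l..r}" "n + 1 \<in> {l..r}" "edge n w w'" for n w w'
    using that gen[of "pt n" "pt (n + 1)" w] gen[of "pt (n + 1)" "pt n" w', THEN rev]
    by (auto simp: edge_def J_eq pt_le_iff split: if_splits)
  have "\<exists>k w. (q, v) = (pt k, w) \<and> w \<in> Ob M (pt k) \<and> dipole J (pt m) u (pt k) w \<in> ?W"
    using assms(3,2) unfolding m J_eq
  proof (induction rule: glue_induct)
    case base
    have "(dipole J (pt m) u (pt m) u :: point \<Rightarrow> 'a \<Rightarrow> 'k) = \<zero>\<^bsub>dsum_free M J\<^esub>"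
      by (auto simp: dipole_def dsum_free_simps)
    then show ?case unfolding J_eq[symmetric] by simp
  next
    case (right n w w')
    then show ?case unfolding J_eq[symmetric] using e comb by blast
  next
    case (left n w w')
    then show ?case unfolding J_eq[symmetric] using e rev comb by blast
  qed
  then show ?thesis using m by auto
qed

text \<open>A nonzero entry cannot be alone in its component, since the total there is 0.
  Subtracting a multiple of the dipole to a second nonzero entry of that component clears the first
  one and alters only the second, so the support shrinks.\<close>

lemma ker_subset_vec_glue:
  fixes y :: "point \<Rightarrow> 'a \<Rightarrow> 'k::field"
  assumes "y \<in> carrier (dsum_free M J)" "\<And>c. ctotal M J y c = 0"
  shows "y \<in> vec_glue (free_diagram M) J"
  using assms
proof (induction "card {(p, u). p \<in> J \<and> y p u \<noteq> 0}" arbitrary: y rule: less_induct)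
  case less
  let ?W = "vec_glue (free_diagram M :: ('k, 'a \<Rightarrow> 'k) vec_diagram) J"
  interpret submodule class_ring ?W "dsum_free M J :: ('k, point \<Rightarrow> 'a \<Rightarrow> 'k) module"
    by (rule submodule_vec_glue)
  let ?S = "\<lambda>y :: point \<Rightarrow> 'a \<Rightarrow> 'k. {(p, u). p \<in> J \<and> y p u \<noteq> 0}"
  have Ob: "u \<in> Ob M p" if "p \<in> J" "y p u \<noteq> 0" for p u
    using that less.prems(1) J_ZZ by (auto simp: dsum_free_simps carrier_free_vs)
  show ?case
  proof (cases "?S y = {}")
    case True
    then have "y = \<zero>\<^bsub>dsum_free M J\<^esub>"
      using less.prems(1) by (intro extensionalityI[of _ J]) (auto simp: dsum_free_simps)
    then show ?thesis by simp
  next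
    case False
    then obtain p u where p: "p \<in> J" "y p u \<noteq> 0" by blast
    define c where "c = set_colim_in M J p u"
    have "\<exists>q v. q \<in> J \<and> y q v \<noteq> 0 \<and> set_colim_in M J q v = c \<and> (q, v) \<noteq> (p, u)"
    proof (rule ccontr)
      assume none: "\<not> ?thesis"
      have "ctotal M J y c = (\<Sum>(q, v)\<in>{(p, u)}. y q v)"
        unfolding ctotal_Sigma
      proof (rule sum.mono_neutral_right)
        show "finite {(p, u). p \<in> J \<and> u \<in> Ob M p \<and> set_colim_in M J p u = c}"
          by (rule finite_subset[OF _ finite_Sigma_Ob]) blast
        show "{(p, u)} \<subseteq> {(p, u). p \<in> J \<and> u \<in> Ob M p \<and> set_colim_in M J p u = c}"
          using p Ob[OF p] c_def by simp
        show "\<forall>z\<in>{(p, u). p \<in> J \<and> u \<in> Ob M p \<and> set_colim_in M J p u = c} - {(p, u)}.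
            (case z of (q, v) \<Rightarrow> y q v) = 0"
        proof
          fix z assume z: "z \<in> {(p, u). p \<in> J \<and> u \<in> Ob M p \<and> set_colim_in M J p u = c} - {(p, u)}"
          obtain q v where qv: "z = (q, v)" by (cases z)
          then have "q \<in> J" "set_colim_in M J q v = c" "(q, v) \<noteq> (p, u)" using z by simp_all
          then have "y q v = 0" using none by blast
          then show "(case z of (q, v) \<Rightarrow> y q v) = 0" using qv by simp
        qed
      qed
      then show False using less.prems(2)[of c] p by simp
    qed
    then obtain q v where q: "q \<in> J" "y q v \<noteq> 0" "set_colim_in M J q v = c" "(q, v) \<noteq> (p, u)" by blast
    let ?d = "dipole J p u q v :: point \<Rightarrow> 'a \<Rightarrow> 'k"
    have d: "?d \<in> ?W"
      using q c_def p Ob by (intro dipole_in_vec_glue) (auto simp flip: set_colim_in_eq_iff)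
    define z where "z = (\<lambda>i\<in>J. \<lambda>x. 1 * y i x + (- y p u) * ?d i x)"
    have "z \<in> ?W"
    proof (rule less.hyps)
      have "?S z \<subset> ?S y"
      proof
        show "?S z \<subseteq> ?S y"
        proof (rule subsetI, elim CollectE case_prodE conjE)
          fix a s x assume a: "a = (s, x)" and s: "s \<in> J" and nz: "z s x \<noteq> 0"
          have "z s x = y s x - y p u * (of_bool ((s, x) = (p, u)) - of_bool ((s, x) = (q, v)))"
            using s by (simp add: z_def dipole_def delta_def)
          then have "y s x \<noteq> 0" using p(2) q(2) nz by (cases "(s, x) = (p, u) \<or> (s, x) = (q, v)") auto
          then show "a \<in> ?S y" using a s by simp
        qed
        have "(p, u) \<notin> ?S z"
          using p q(4) by (auto simp: z_def dipole_def delta_def)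
        then show "?S z \<noteq> ?S y" using p by blast
      qed
      moreover have "finite (?S y)"
        by (rule finite_subset[OF _ finite_Sigma_Ob]) (use Ob in blast)
      ultimately show "card (?S z) < card (?S y)" by (intro psubset_card_mono)
      have dc: "?d \<in> carrier (dsum_free M J)" using d subset by blast
      then show "z \<in> carrier (dsum_free M J)"
        unfolding z_def using less.prems(1) by (intro dsum_free_lincomb_closed)
      have "ctotal M J ?d c = 0" for c using d vec_glue_subset_ker by blast
      then show "ctotal M J z c = 0" for c
        unfolding z_def ctotal_lincomb using less.prems(2) by simp
    qed
    moreover have "y = (\<lambda>i\<in>J. \<lambda>x. 1 * z i x + y p u * ?d i x)"
      using less.prems(1) by (intro extensionalityI[of _ J]) (auto simp: z_def dsum_free_simps)
    ultimately show ?thesis using vec_glue_lincomb[OF _ d, of z 1 "y p u"] by simp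
  qed
qed

lemma vec_glue_eq_ker:
  "vec_glue (free_diagram M) J = {y \<in> carrier (dsum_free M J). \<forall>c. ctotal M J y c = (0::'k::field)}"
  using vec_glue_subset_ker ker_subset_vec_glue by blast

text \<open>The cosets of \<open>vec_glue\<close> are the nonempty fibers of \<open>ctotal\<close>,
  so an element of the colimit can be named by its totals.\<close>

definition fiber :: "((point \<times> 'a) set \<Rightarrow> 'k::field) \<Rightarrow> (point \<Rightarrow> 'a \<Rightarrow> 'k) set" where
  "fiber f = {y \<in> carrier (dsum_free M J). ctotal M J y = f}"

lemma coset_eq_fiber:
  fixes y :: "point \<Rightarrow> 'a \<Rightarrow> 'k::field"
  assumes y: "y \<in> carrier (dsum_free M J)"
  shows "vec_glue (free_diagram M) J +>\<^bsub>dsum_free M J\<^esub> y = fiber (ctotal M J y)"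
proof (rule Set.set_eqI)
  fix z :: "point \<Rightarrow> 'a \<Rightarrow> 'k"
  let ?W = "vec_glue (free_diagram M :: ('k, 'a \<Rightarrow> 'k) vec_diagram) J"
  have "z \<in> ?W +>\<^bsub>dsum_free M J\<^esub> y \<longleftrightarrow> (\<exists>w\<in>?W. z = (\<lambda>i\<in>J. \<lambda>x. 1 * w i x + 1 * y i x))"
    by (auto simp: a_r_coset_def' dsum_free_simps(3))
  also have "\<dots> \<longleftrightarrow> z \<in> fiber (ctotal M J y)"
  proof
    assume "\<exists>w\<in>?W. z = (\<lambda>i\<in>J. \<lambda>x. 1 * w i x + 1 * y i x)"
    then obtain w where w: "w \<in> carrier (dsum_free M J)" "\<And>c. ctotal M J w c = 0"
      and z: "z = (\<lambda>i\<in>J. \<lambda>x. 1 * w i x + 1 * y i x)"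
      unfolding vec_glue_eq_ker by blast
    have "z \<in> carrier (dsum_free M J)"
      unfolding z by (rule dsum_free_lincomb_closed[OF w(1) y])
    moreover have "ctotal M J z = ctotal M J y"
      unfolding z using ctotal_lincomb[of 1 w 1 y] w(2) by (simp add: fun_eq_iff)
    ultimately show "z \<in> fiber (ctotal M J y)" by (simp add: fiber_def)
  next
    assume "z \<in> fiber (ctotal M J y)"
    then have z: "z \<in> carrier (dsum_free M J)" "ctotal M J z = ctotal M J y"
      by (simp_all add: fiber_def)
    let ?w = "\<lambda>i\<in>J. \<lambda>x. 1 * z i x + (- 1) * y i x"
    have "?w \<in> ?W"
      unfolding vec_glue_eq_ker using dsum_free_lincomb_closed[OF z(1) y, of 1 "- 1"] z(2) ctotal_lincomb[of 1 z "- 1" y]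
      by simp
    moreover have "z = (\<lambda>i\<in>J. \<lambda>x. 1 * ?w i x + 1 * y i x)"
      using z(1) by (intro extensionalityI[of _ J]) (simp_all add: dsum_free_simps)
    ultimately show "\<exists>w\<in>?W. z = (\<lambda>i\<in>J. \<lambda>x. 1 * w i x + 1 * y i x)" by blast
  qed
  finally show "z \<in> ?W +>\<^bsub>dsum_free M J\<^esub> y \<longleftrightarrow> z \<in> fiber (ctotal M J y)" .
qed

lemma tot_section_in_free_vs:
  assumes "x \<in> sections J" "p \<in> J"
  shows "tot M J p (x p) \<in> carrier (free_vs (full_comps M J))"
  using assms tot_section_not_full[of x l r p] finite_full_comps[of l r]
  by (simp add: carrier_free_vs J_eq)

text \<open>Combine the sections that start at a single element of each full component, with the
  values of \<open>f\<close> as coefficients. Totals are constant along a section, so they need to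
  be computed only at the left end, where these sections are deltas.\<close>

lemma ex_section_tot:
  fixes f :: "(point \<times> 'a) set \<Rightarrow> 'k::field"
  assumes f: "f \<in> carrier (free_vs (full_comps M J))" and a: "a \<in> J"
  shows "\<exists>x\<in>sections J. tot M J a (x a) = f"
proof -
  let ?C = "full_comps M J"
  have C: "finite ?C" using finite_full_comps J_eq by simp
  have "\<forall>c\<in>?C. \<exists>u x. u \<in> Ob M (pt l) \<and> set_colim_in M J (pt l) u = c \<and>
      x \<in> sections J \<and> x (pt l) = (delta u :: 'a \<Rightarrow> 'k)"
    using ex_section_full lr unfolding J_eq by blast
  then obtain u x where ux: "\<And>c. c \<in> ?C \<Longrightarrow> u c \<in> Ob M (pt l)"
      "\<And>c. c \<in> ?C \<Longrightarrow> set_colim_in M J (pt l) (u c) = c"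
      "\<And>c. c \<in> ?C \<Longrightarrow> x c \<in> sections J"
      "\<And>c. c \<in> ?C \<Longrightarrow> x c (pt l) = (delta (u c) :: 'a \<Rightarrow> 'k)"
    by metis
  define s where "s p y = (\<Sum>c\<in>?C. f c * x c p y)" for p y
  have xc: "x c p \<in> carrier (free_vs (Ob M p))" if "c \<in> ?C" "p \<in> J" for c p
    using ux(3)[OF that(1)] that(2) unfolding sections_def by blast
  have "s \<in> sections J"
    unfolding sections_def
  proof (intro CollectI conjI ballI impI)
    fix p assume p: "p \<in> J"
    then show "s p \<in> carrier (free_vs (Ob M p))"
      using xc[OF _ p] unfolding carrier_free_vs[OF finite_Ob[OF J_ZZ[OF p]]]
      by (auto simp: s_def intro!: sum.neutral)
    fix q assume q: "q \<in> J" "p \<preceq> q"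
    have "free_map (Ar M p q) (s p) = (\<lambda>y. \<Sum>c\<in>?C. f c * free_map (Ar M p q) (x c p) y)"
      unfolding s_def by (rule free_map_sum[OF finite_Ob[OF J_ZZ[OF p]]]) (rule xc[OF _ p])
    also have "\<dots> = s q"
      using ux(3) p q unfolding s_def sections_def by (intro ext sum.cong refl) force
    finally show "free_map (Ar M p q) (s p) = s q" .
  qed
  moreover have "tot M J a (s a) = f"
  proof
    fix c
    have ptl: "pt l \<in> J" using lr J_eq by simp
    have "tot M J a (s a) c = tot M J (pt l) (s (pt l)) c"
      using tot_section[of s l r a "pt l" c] \<open>s \<in> sections J\<close> a ptl unfolding J_eq by blast
    also have "\<dots> = (\<Sum>d\<in>?C. f d * tot M J (pt l) (x d (pt l)) c)"
      unfolding s_def by (rule tot_sum)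
    also have "\<dots> = (\<Sum>d\<in>?C. if d = c then f c else 0)"
      using ux(1,2,4) by (intro sum.cong refl) (simp add: tot_delta)
    also have "\<dots> = f c"
      using f C by (simp add: carrier_free_vs)
    finally show "tot M J a (s a) c = f c" .
  qed
  ultimately show ?thesis by blast
qed

section \<open>The rank over a finite interval\<close>

lemma carrier_vec_lim:
  "carrier (vec_lim (free_diagram M :: ('k::field, 'a \<Rightarrow> 'k) vec_diagram) J) = {x \<in> sections J. x \<in> extensional J}"
  by (auto simp: vec_lim_def vs_prod_def PiE_def Pi_def sections_def free_diagram_def)

lemma image_lim_to_colim:
  "lim_to_colim (free_diagram M :: ('k::field, 'a \<Rightarrow> 'k) vec_diagram) J ` carrier (vec_lim (free_diagram M) J) =
    fiber ` carrier (free_vs (full_comps M J))" (is "?f ` ?L = _")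
proof -
  \<comment> \<open>The point chosen by \<open>lim_to_colim\<close>, of which only membership in
    \<open>J\<close> is known. Hence totals are compared at an arbitrary point rather than at the
    left end.\<close>
  define a where "a = (SOME a. a \<in> J)"
  have "pt l \<in> J" using lr J_eq by simp
  then have a: "a \<in> J" unfolding a_def by (rule someI)
  have f: "?f x = fiber (tot M J a (x a))" if "x \<in> sections J" for x
  proof -
    have "x a \<in> carrier (free_vs (Ob M a))" using that a unfolding sections_def by blast
    then have "vec_colim_in (free_diagram M) J a (x a) =
        fiber (ctotal M J (vs_dsum_in J (Ob (free_diagram M)) a (x a)))"
      unfolding vec_colim_in_def by (intro coset_eq_fiber vs_dsum_in_closed[OF a])
    also have "ctotal M J (vs_dsum_in J (Ob (free_diagram M)) a (x a)) = tot M J a (x a)"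
      using ctotal_vs_dsum_in[OF a] by (intro ext)
    finally show ?thesis by (simp add: lim_to_colim_def a_def[symmetric])
  qed
  show ?thesis
  proof (intro subset_antisym image_subsetI)
    fix x assume "x \<in> ?L"
    then have "x \<in> sections J" unfolding carrier_vec_lim by blast
    then show "?f x \<in> fiber ` carrier (free_vs (full_comps M J))"
      using f tot_section_in_free_vs a by blast
  next
    fix g :: "(point \<times> 'a) set \<Rightarrow> 'k" assume "g \<in> carrier (free_vs (full_comps M J))"
    then obtain x where x: "x \<in> sections J" "tot M J a (x a) = g"
      using ex_section_tot a by blast
    have "restrict x J \<in> sections J" using x(1) by (simp add: sections_def)
    moreover have "restrict x J \<in> ?L" using \<open>restrict x J \<in> sections J\<close> unfolding carrier_vec_lim by simp
    ultimately show "fiber g \<in> ?f ` ?L" using f[of "restrict x J"] x(2) a by (intro image_eqI[of _ _ "restrict x J"]) simp_all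
  qed
qed

text \<open>Empty fibers would spoil both the injectivity of \<open>fiber\<close> and the
  computation of sums and multiples of cosets.\<close>

lemma fiber_nonempty:
  fixes f :: "(point \<times> 'a) set \<Rightarrow> 'k::field"
  assumes "f \<in> carrier (free_vs (full_comps M J))"
  obtains y where "y \<in> carrier (dsum_free M J)" "ctotal M J y = f"
proof -
  have p: "pt l \<in> J" using lr J_eq by simp
  obtain x where x: "x \<in> sections J" "tot M J (pt l) (x (pt l)) = f"
    using ex_section_tot[OF assms p] by blast
  then have "x (pt l) \<in> carrier (free_vs (Ob M (pt l)))" using p unfolding sections_def by blast
  then show ?thesis
    using that[OF vs_dsum_in_closed[OF p]] ctotal_vs_dsum_in[OF p] x(2) by blast
qed

text \<open>\<open>fiber\<close> is an isomorphism from the free space on the full components onto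
  the image of the limit, with the coset operations of the quotient.\<close>

lemma rk_eq_Full: "rk (free_diagram M :: ('k::field, 'a \<Rightarrow> 'k) vec_diagram) J = Full M J"
proof -
  let ?F = "carrier (free_vs (full_comps M J) :: ('k, (point \<times> 'a) set \<Rightarrow> 'k) module)"
  let ?W = "vec_glue (free_diagram M :: ('k, 'a \<Rightarrow> 'k) vec_diagram) J"
  let ?H = "dsum_free M J :: ('k, point \<Rightarrow> 'a \<Rightarrow> 'k) module"
  have mem: "y \<in> fiber f \<longleftrightarrow> y \<in> carrier ?H \<and> ctotal M J y = f" for y and f :: "_ \<Rightarrow> 'k"
    by (simp add: fiber_def)
  have total_comb: "ctotal M J (\<lambda>i\<in>J. \<lambda>x. a * y i x + b * z i x) = (\<lambda>c. a * ctotal M J y c + b * ctotal M J z c)"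
    for a b and y z :: "point \<Rightarrow> 'a \<Rightarrow> 'k"
    using ctotal_lincomb by blast
  have add: "fiber f <+>\<^bsub>?H\<^esub> fiber g = fiber (\<lambda>c. f c + g c)" if fF: "f \<in> ?F" for f g
  proof (rule Set.set_eqI)
    fix w
    have "w \<in> fiber f <+>\<^bsub>?H\<^esub> fiber g \<longleftrightarrow>
        (\<exists>y\<in>fiber f. \<exists>z\<in>fiber g. w = (\<lambda>i\<in>J. \<lambda>x. 1 * y i x + 1 * z i x))"
      by (auto simp: set_add_def' dsum_free_simps(3))
    also have "\<dots> \<longleftrightarrow> w \<in> fiber (\<lambda>c. f c + g c)"
    proof
      assume "\<exists>y\<in>fiber f. \<exists>z\<in>fiber g. w = (\<lambda>i\<in>J. \<lambda>x. 1 * y i x + 1 * z i x)"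
      then obtain y z where "y \<in> fiber f" "z \<in> fiber g"
        and w: "w = (\<lambda>i\<in>J. \<lambda>x. 1 * y i x + 1 * z i x)" by blast
      then show "w \<in> fiber (\<lambda>c. f c + g c)"
        using dsum_free_lincomb_closed[of y z 1 1] unfolding w mem total_comb by simp
    next
      assume w: "w \<in> fiber (\<lambda>c. f c + g c)"
      \<comment> \<open>Any element of the first fiber serves as a summand: the remainder has the
        totals \<open>g\<close>.\<close>
      obtain y where y: "y \<in> carrier ?H" "ctotal M J y = f" using fiber_nonempty[OF fF] by blast
      let ?z = "\<lambda>i\<in>J. \<lambda>x. 1 * w i x + (- 1) * y i x"
      have "?z \<in> fiber g"
        using w y dsum_free_lincomb_closed[of w y 1 "- 1"] unfolding mem total_comb by simp
      moreover have "w = (\<lambda>i\<in>J. \<lambda>x. 1 * y i x + 1 * ?z i x)"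
        using w unfolding mem by (intro extensionalityI[of _ J]) (simp_all add: dsum_free_simps)
      moreover have "y \<in> fiber f" using y by (simp add: mem)
      ultimately show "\<exists>y\<in>fiber f. \<exists>z\<in>fiber g. w = (\<lambda>i\<in>J. \<lambda>x. 1 * y i x + 1 * z i x)"
        by (intro bexI[of _ y] bexI[of _ ?z])
    qed
    finally show "w \<in> fiber f <+>\<^bsub>?H\<^esub> fiber g \<longleftrightarrow> w \<in> fiber (\<lambda>c. f c + g c)" .
  qed
  have smult: "(\<Union>y\<in>fiber f. ?W +>\<^bsub>?H\<^esub> (a \<odot>\<^bsub>?H\<^esub> y)) = fiber (\<lambda>c. a * f c)" if fF: "f \<in> ?F" for f a
  proof -
    have "?W +>\<^bsub>?H\<^esub> (a \<odot>\<^bsub>?H\<^esub> y) = fiber (\<lambda>c. a * f c)" if "y \<in> fiber f" for y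
    proof -
      have "a \<odot>\<^bsub>?H\<^esub> y = (\<lambda>i\<in>J. \<lambda>x. a * y i x + 0 * y i x)" by (simp add: dsum_free_simps(4))
      then have "a \<odot>\<^bsub>?H\<^esub> y \<in> carrier ?H" "ctotal M J (a \<odot>\<^bsub>?H\<^esub> y) = (\<lambda>c. a * f c)"
        using that dsum_free_lincomb_closed[of y y a 0] total_comb[of a y 0 y] unfolding mem by simp_all
      then show ?thesis using coset_eq_fiber by metis
    qed
    note coset = this
    \<comment> \<open>The union of equal cosets is that coset only if the index set is
      nonempty.\<close>
    obtain y where "y \<in> fiber f" using fiber_nonempty[OF fF] mem[THEN iffD2] by metis
    then have "fiber f \<noteq> {}" by blast
    then show ?thesis by (simp add: coset cong: SUP_cong)
  qed
  have "vectorspace.dim class_ring ((vec_colim (free_diagram M :: ('k, 'a \<Rightarrow> 'k) vec_diagram) J)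
      \<lparr>carrier := fiber ` ?F\<rparr>) = card (full_comps M J)"
  proof (rule dim_eq_card_if_bij)
    show "finite (full_comps M J)" using finite_full_comps J_eq by simp
    have "inj_on fiber ?F"
    proof (rule inj_onI)
      fix f g assume "f \<in> ?F" "g \<in> ?F" "fiber f = fiber g"
      then show "f = g" using fiber_nonempty[of f] mem by metis
    qed
    then show "bij_betw fiber ?F (carrier ((vec_colim (free_diagram M :: ('k, 'a \<Rightarrow> 'k) vec_diagram) J)\<lparr>carrier := fiber ` ?F\<rparr>))"
      by (simp add: bij_betw_def)
    have "fiber (\<lambda>x. 0) = ?W" by (auto simp: mem vec_glue_eq_ker fun_eq_iff)
    then show "\<zero>\<^bsub>vec_colim (free_diagram M :: ('k, 'a \<Rightarrow> 'k) vec_diagram) J\<lparr>carrier := fiber ` ?F\<rparr>\<^esub> = fiber (\<lambda>x. 0)"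
      by (simp add: vec_colim_def vs_quot_simps)
  qed (simp_all add: vec_colim_def vs_quot_simps add smult)
  then show ?thesis
    by (simp add: rk_def image_lim_to_colim Full_def full_comps_def)
qed

end

end

section \<open>Bars and full components\<close>

abbreviation bars :: "(point set \<Rightarrow> nat) \<Rightarrow> (point set \<times> nat) set" where
  "bars B \<equiv> {(K, n). n < B K}"

abbreviation bar_diagram :: "(point set \<Rightarrow> nat) \<Rightarrow> ('k::field, point set \<times> nat \<Rightarrow> 'k) vec_diagram" where
  "bar_diagram B \<equiv> dsum_diagram (bars B) (\<lambda>(K, n). interval_module K)"

lemma carrier_bar_diagram:
  "x \<in> carrier (Ob (bar_diagram B :: ('k::field, point set \<times> nat \<Rightarrow> 'k) vec_diagram) p) \<longleftrightarrow>
    x \<in> extensional (bars B) \<and> (\<forall>d\<in>bars B. p \<notin> fst d \<longrightarrow> x d = 0) \<and>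
    finite {d \<in> bars B. x d \<noteq> 0}"
proof -
  have C: "carrier (Ob ((case d of (K, n) \<Rightarrow> interval_module K) :: ('k, 'k) vec_diagram) p) =
      (if p \<in> fst d then UNIV else {0})"
    and Z: "\<zero>\<^bsub>Ob ((case d of (K, n) \<Rightarrow> interval_module K) :: ('k, 'k) vec_diagram) p\<^esub> = 0" for d :: "point set \<times> nat"
    by (auto simp: interval_module_def split: prod.split)
  show ?thesis
    by (simp only: dsum_diagram_def diagram.simps vs_dsum_def vs_prod_def module.simps partial_object.simps
        ring.simps C Z mem_Collect_eq PiE_def Int_iff Pi_iff) (auto split: if_splits)
qed

lemma bar_diagram_simps:
  fixes x y :: "point set \<times> nat \<Rightarrow> 'k::field"
  shows "x \<oplus>\<^bsub>Ob (bar_diagram B) p\<^esub> y = (\<lambda>d\<in>bars B. x d + y d)"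
    and "a \<odot>\<^bsub>Ob (bar_diagram B) p\<^esub> x = (\<lambda>d\<in>bars B. a * x d)"
    and "Ar (bar_diagram B) p q x = (\<lambda>d\<in>bars B. if p \<in> fst d \<and> q \<in> fst d then x d else 0)"
  by (auto simp: dsum_diagram_def vs_dsum_def vs_prod_def interval_module_def split: prod.split
      intro!: restrict_ext)

text \<open>Names the isomorphism whose existence \<open>is_barcode\<close> asserts. That the bars
  are intervals enters only in the inclusion-exclusion.\<close>

locale barcode_iso = finite_sets_on_ZZ M
  for M :: "'a set_diagram" +
  fixes B :: "point set \<Rightarrow> nat" and \<eta> :: "point \<Rightarrow> ('a \<Rightarrow> 'k::field) \<Rightarrow> point set \<times> nat \<Rightarrow> 'k"
  assumes hom: "p \<in> ZZ \<Longrightarrow> \<eta> p \<in>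
      LinearCombinations.module_hom class_ring (free_vs (Ob M p)) (Ob (bar_diagram B) p)"
    and bij: "p \<in> ZZ \<Longrightarrow> bij_betw (\<eta> p) (carrier (free_vs (Ob M p))) (carrier (Ob (bar_diagram B) p))"
    and natural: "p \<in> ZZ \<Longrightarrow> q \<in> ZZ \<Longrightarrow> p \<preceq> q \<Longrightarrow> f \<in> carrier (free_vs (Ob M p)) \<Longrightarrow>
      \<eta> q (free_map (Ar M p q) f) = Ar (bar_diagram B) p q (\<eta> p f)"
begin

lemma \<eta>_closed:
  "p \<in> ZZ \<Longrightarrow> f \<in> carrier (free_vs (Ob M p)) \<Longrightarrow> \<eta> p f \<in> carrier (Ob (bar_diagram B) p)"
  using bij[of p] by (auto simp: bij_betw_def)

lemma \<eta>_outside: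
  assumes "p \<in> ZZ" "f \<in> carrier (free_vs (Ob M p))" "d \<in> bars B" "p \<notin> fst d"
  shows "\<eta> p f d = 0"
  using \<eta>_closed[OF assms(1,2)] assms(3,4) unfolding carrier_bar_diagram by blast

lemma \<eta>_add:
  assumes "p \<in> ZZ" "f \<in> carrier (free_vs (Ob M p))" "g \<in> carrier (free_vs (Ob M p))" "d \<in> bars B"
  shows "\<eta> p (\<lambda>x. f x + g x) d = \<eta> p f d + \<eta> p g d"
  using LinearCombinations.module_hom_add[OF hom[OF assms(1)] assms(2,3)] assms(4) by (simp add: bar_diagram_simps)

lemma \<eta>_mult:
  assumes "p \<in> ZZ" "f \<in> carrier (free_vs (Ob M p))" "d \<in> bars B"
  shows "\<eta> p (\<lambda>x. a * f x) d = a * \<eta> p f d"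
  using LinearCombinations.module_hom_smult[OF hom[OF assms(1)] _ assms(2), of a] assms(3) by (simp add: bar_diagram_simps)

lemma free_vs_sum_closed:
  assumes "p \<in> ZZ" "\<And>i. i \<in> S \<Longrightarrow> f i \<in> carrier (free_vs (Ob M p))"
  shows "(\<lambda>x. \<Sum>i\<in>S. a i * f i x :: 'k) \<in> carrier (free_vs (Ob M p))"
  using assms(2) unfolding carrier_free_vs[OF finite_Ob[OF assms(1)]] by (auto intro!: sum.neutral)

lemma \<eta>_sum:
  assumes p: "p \<in> ZZ" and "finite S" and "\<And>i. i \<in> S \<Longrightarrow> f i \<in> carrier (free_vs (Ob M p))"
    and d: "d \<in> bars B"
  shows "\<eta> p (\<lambda>x. \<Sum>i\<in>S. a i * f i x) d = (\<Sum>i\<in>S. a i * \<eta> p (f i) d)"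
  using assms(2,3)
proof (induction S rule: finite_induct)
  case empty
  have "(\<lambda>x. 0) \<in> carrier (free_vs (Ob M p) :: ('k, 'a \<Rightarrow> 'k) module)" by (simp add: free_vs_def)
  from \<eta>_mult[OF p this d, of 0] show ?case by simp
next
  case (insert i S)
  have "(\<lambda>x. a i * f i x) \<in> carrier (free_vs (Ob M p))"
    using insert.prems[of i] unfolding carrier_free_vs[OF finite_Ob[OF p]] by simp
  moreover have "(\<lambda>x. \<Sum>i\<in>S. a i * f i x) \<in> carrier (free_vs (Ob M p))"
    using insert.prems by (intro free_vs_sum_closed[OF p]) simp
  ultimately show ?case
    using insert \<eta>_add[OF p _ _ d, of "\<lambda>x. a i * f i x" "\<lambda>x. \<Sum>i\<in>S. a i * f i x"]
      \<eta>_mult[OF p _ d, of "f i" "a i"] by simp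
qed

lemma \<eta>_eqI:
  assumes p: "p \<in> ZZ" and fg: "f \<in> carrier (free_vs (Ob M p))" "g \<in> carrier (free_vs (Ob M p))"
    and eq: "\<And>d. d \<in> bars B \<Longrightarrow> \<eta> p f d = \<eta> p g d"
  shows "f = g"
proof -
  have "\<eta> p f \<in> extensional (bars B)" "\<eta> p g \<in> extensional (bars B)"
    using \<eta>_closed[OF p fg(1)] \<eta>_closed[OF p fg(2)] unfolding carrier_bar_diagram by blast+
  then have "\<eta> p f = \<eta> p g" using eq by (rule extensionalityI)
  then show ?thesis using bij[OF p] fg by (auto simp: bij_betw_def inj_on_def)
qed

text \<open>The basis vector of the bar \<open>d\<close>, transported to the free space at
  \<open>p\<close>. Off the bar that basis vector is missing from the carrier and
  \<open>inv_into\<close> returns an arbitrary value, whence the condition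
  \<open>p \<in> fst d\<close> below.\<close>

definition bar_vec :: "point set \<times> nat \<Rightarrow> point \<Rightarrow> 'a \<Rightarrow> 'k" where
  "bar_vec d p = inv_into (carrier (free_vs (Ob M p))) (\<eta> p) (\<lambda>d'\<in>bars B. if d' = d then 1 else 0)"

lemma
  assumes "p \<in> ZZ" "d \<in> bars B" "p \<in> fst d"
  shows bar_vec_closed: "bar_vec d p \<in> carrier (free_vs (Ob M p))"
    and \<eta>_bar_vec: "d' \<in> bars B \<Longrightarrow> \<eta> p (bar_vec d p) d' = (if d' = d then 1 else 0)"
proof -
  let ?e = "\<lambda>d'\<in>bars B. if d' = d then 1 else 0 :: 'k"
  have "?e \<in> carrier (Ob (bar_diagram B) p)"
    unfolding carrier_bar_diagram
  proof (intro conjI ballI impI)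
    show "finite {d' \<in> bars B. ?e d' \<noteq> 0}"
      by (rule finite_subset[of _ "{d}"]) auto
    fix d' assume "d' \<in> bars B" "p \<notin> fst d'"
    then show "?e d' = 0" using assms(3) by auto
  qed simp
  then have im: "?e \<in> \<eta> p ` carrier (free_vs (Ob M p))" using bij[OF assms(1)] by (simp add: bij_betw_def)
  show "bar_vec d p \<in> carrier (free_vs (Ob M p))"
    unfolding bar_vec_def by (rule inv_into_into[OF im])
  show "\<eta> p (bar_vec d p) d' = (if d' = d then 1 else 0)" if "d' \<in> bars B"
    unfolding bar_vec_def f_inv_into_f[OF im] using that by simp
qed

lemma free_map_bar_vec:
  assumes pq: "p \<in> ZZ" "q \<in> ZZ" "p \<preceq> q" and d: "d \<in> bars B" "p \<in> fst d"
  shows "free_map (Ar M p q) (bar_vec d p) = (if q \<in> fst d then bar_vec d q else (\<lambda>x. 0))"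
proof (rule \<eta>_eqI[OF pq(2)])
  note closed = bar_vec_closed[OF pq(1) d]
  show "free_map (Ar M p q) (bar_vec d p) \<in> carrier (free_vs (Ob M q))"
    using pq closed by (intro free_map_closed[of "Ob M p"]) auto
  have zero: "(\<lambda>x. 0) \<in> carrier (free_vs (Ob M q) :: ('k, 'a \<Rightarrow> 'k) module)" by (simp add: free_vs_def)
  then show "(if q \<in> fst d then bar_vec d q else (\<lambda>x. 0)) \<in> carrier (free_vs (Ob M q))"
    using bar_vec_closed[OF pq(2) d(1)] by simp
  fix d' assume d': "d' \<in> bars B"
  have "\<eta> q (free_map (Ar M p q) (bar_vec d p)) d' =
      (if p \<in> fst d' \<and> q \<in> fst d' then \<eta> p (bar_vec d p) d' else 0)"
    using natural[OF pq closed] d' by (simp add: bar_diagram_simps)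
  also have "\<dots> = (if q \<in> fst d then if d' = d then 1 else 0 else 0)"
    using \<eta>_bar_vec[OF pq(1) d d'] d by auto
  also have "\<dots> = \<eta> q (if q \<in> fst d then bar_vec d q else (\<lambda>x. 0)) d'"
    using \<eta>_bar_vec[OF pq(2) d(1) _ d'] \<eta>_mult[OF pq(2) zero d', of 0] by simp
  finally show "\<eta> q (free_map (Ar M p q) (bar_vec d p)) d' =
      \<eta> q (if q \<in> fst d then bar_vec d q else (\<lambda>x. 0)) d'" .
qed

text \<open>The sum is confined to nonzero coordinates: they are finitely many even if the bars are
  not, and their bars pass through \<open>p\<close>, where \<open>bar_vec\<close> is
  meaningful.\<close>

lemma bar_vec_expansion:
  assumes p: "p \<in> ZZ" and f: "f \<in> carrier (free_vs (Ob M p))"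
  shows "f = (\<lambda>x. \<Sum>d\<in>{d \<in> bars B. \<eta> p f d \<noteq> 0}. \<eta> p f d * bar_vec d p x)"
proof (rule \<eta>_eqI[OF p f])
  let ?S = "{d \<in> bars B. \<eta> p f d \<noteq> 0}"
  have S: "finite ?S" using \<eta>_closed[OF p f] unfolding carrier_bar_diagram by blast
  have closed: "bar_vec d p \<in> carrier (free_vs (Ob M p))" if "d \<in> ?S" for d
    using that \<eta>_outside[OF p f, of d] by (intro bar_vec_closed[OF p]) auto
  then show "(\<lambda>x. \<Sum>d\<in>?S. \<eta> p f d * bar_vec d p x) \<in> carrier (free_vs (Ob M p))"
    by (rule free_vs_sum_closed[OF p])
  fix d assume d: "d \<in> bars B"
  have "\<eta> p (\<lambda>x. \<Sum>d\<in>?S. \<eta> p f d * bar_vec d p x) d = (\<Sum>d'\<in>?S. \<eta> p f d' * \<eta> p (bar_vec d' p) d)"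
    by (rule \<eta>_sum[OF p S closed d])
  also have "\<dots> = (\<Sum>d'\<in>?S. if d' = d then \<eta> p f d else 0)"
  proof (rule sum.cong[OF refl])
    fix d' assume d': "d' \<in> ?S"
    then have "p \<in> fst d'" using \<eta>_outside[OF p f, of d'] by auto
    then have "\<eta> p (bar_vec d' p) d = (if d = d' then 1 else 0)"
      using d' by (intro \<eta>_bar_vec[OF p _ _ d]) auto
    then show "\<eta> p f d' * \<eta> p (bar_vec d' p) d = (if d' = d then \<eta> p f d else 0)" by simp
  qed
  also have "\<dots> = \<eta> p f d" using S d by simp
  finally show "\<eta> p f d = \<eta> p (\<lambda>x. \<Sum>d\<in>?S. \<eta> p f d * bar_vec d p x) d" by simp
qed

text \<open>On a bar containing the whole interval, naturality preserves the coordinate across each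
  edge. So the coordinate of an element depends only on its component, which makes the matrix
  \<open>P\<close> below independent of the chosen representatives.\<close>

lemma \<eta>_delta_glue:
  assumes d: "d \<in> bars B" "pt ` {l..r} \<subseteq> fst d"
    and glue: "((pt m, u), (q, v)) \<in> glue M (pt ` {l..r})" "u \<in> Ob M (pt m)"
  shows "\<eta> q (delta v) d = \<eta> (pt m) (delta u) d"
proof -
  have step: "\<eta> t (delta (Ar M s t w)) d = \<eta> s (delta w) d"
    if "s \<in> ZZ" "t \<in> ZZ" "s \<preceq> t" "w \<in> Ob M s" "s \<in> fst d" "t \<in> fst d" for s t w
    using natural[OF that(1,2,3), of "delta w"] that d(1)
    by (simp add: free_map_delta[of "Ob M s"] bar_diagram_simps)
  have edge: "\<eta> (pt (n + 1)) (delta v) d = \<eta> (pt n) (delta u) d"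
    if "n \<in> {l..r}" "n + 1 \<in> {l..r}" "edge n u v" for n u v
  proof -
    have "pt n \<in> fst d" "pt (n + 1) \<in> fst d" using that(1,2) d(2) by auto
    then show ?thesis
      using that(3) step[of "pt n" "pt (n + 1)" u] step[of "pt (n + 1)" "pt n" v]
      by (auto simp: edge_def pt_le_iff split: if_splits)
  qed
  have "\<exists>k w. (q, v) = (pt k, w) \<and> w \<in> Ob M (pt k) \<and> \<eta> (pt k) (delta w) d = \<eta> (pt m) (delta u) d"
    using glue by (induction rule: glue_induct) (use edge in auto)
  then show ?thesis by auto
qed

lemma bar_vec_section:
  assumes d: "d \<in> bars B" "pt ` {l..r} \<subseteq> fst d"
  shows "bar_vec d \<in> sections (pt ` {l..r})"
  unfolding sections_def
proof (intro CollectI conjI ballI impI)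
  fix p assume p: "p \<in> pt ` {l..r}"
  then have pz: "p \<in> ZZ" "p \<in> fst d" using d by auto
  then show "bar_vec d p \<in> carrier (free_vs (Ob M p))" using d by (intro bar_vec_closed)
  fix q assume q: "q \<in> pt ` {l..r}" "p \<preceq> q"
  then have "q \<in> ZZ" "q \<in> fst d" using d by auto
  then show "free_map (Ar M p q) (bar_vec d p) = bar_vec d q"
    using free_map_bar_vec[OF pz(1) _ q(2) d(1) pz(2)] by simp
qed

text \<open>Let \<open>k\<close> be the last point before the bar is first left. Up to
  \<open>k\<close> both the coordinate of \<open>s\<close> and the total of the bar vector are
  constant. An arrow from \<open>k + 1\<close> to \<open>k\<close> would make the coordinate at
  \<open>k\<close> zero, contrary to \<open>nz\<close>. So the arrow goes from \<open>k\<close> to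
  \<open>k + 1\<close>; it preserves totals and sends the bar vector to 0.\<close>

lemma tot_bar_vec_zero:
  assumes d: "d \<in> bars B" "\<not> pt ` {l..r} \<subseteq> fst d" and s: "s \<in> sections (pt ` {l..r})"
    and nz: "\<eta> (pt l) (s (pt l)) d \<noteq> 0" and lr: "l \<le> r"
  shows "tot M (pt ` {l..r}) (pt l) (bar_vec d (pt l)) c = 0"
proof -
  let ?J = "pt ` {l..r}"
  have sc: "s (pt n) \<in> carrier (free_vs (Ob M (pt n)))" if "n \<in> {l..r}" for n
    using s that unfolding sections_def by blast
  have sm: "free_map (Ar M (pt m) (pt n)) (s (pt m)) = s (pt n)"
    if "m \<in> {l..r}" "n \<in> {l..r}" "pt m \<preceq> pt n" for m n
    using s that unfolding sections_def by blast
  have l: "pt l \<in> fst d"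
    using \<eta>_outside[OF _ sc d(1), of l] nz lr by auto
  have "\<exists>k. l \<le> k \<and> k < r \<and> (\<forall>n\<in>{l..k}. pt n \<in> fst d) \<and> pt (k + 1) \<notin> fst d"
  proof (rule ccontr)
    assume none: "\<not> ?thesis"
    have "\<forall>n\<in>{l..k}. pt n \<in> fst d" if "l \<le> k" "k \<le> r" for k
      using that
    proof (induction k rule: int_ge_induct)
      case base
      then show ?case using l by simp
    next
      case (step k)
      then have IH: "\<forall>n\<in>{l..k}. pt n \<in> fst d" by simp
      then have "pt (k + 1) \<in> fst d" using none step.prems step.hyps by force
      moreover have "{l..k + 1} = insert (k + 1) {l..k}" using step by auto
      ultimately show ?case using IH by simp
    qed
    then show False using d(2) lr by auto
  qed
  then obtain k where k: "l \<le> k" "k < r" "\<And>n. n \<in> {l..k} \<Longrightarrow> pt n \<in> fst d" "pt (k + 1) \<notin> fst d" by blast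
  have \<eta>_le: "\<eta> (pt n) (s (pt n)) d = (if pt m \<in> fst d \<and> pt n \<in> fst d then \<eta> (pt m) (s (pt m)) d else 0)"
    if "m \<in> {l..r}" "n \<in> {l..r}" "pt m \<preceq> pt n" for m n
    using natural[OF pt_in_ZZ pt_in_ZZ that(3) sc[OF that(1)]] sm[OF that] d(1)
    by (simp add: bar_diagram_simps)
  have tot_le: "tot M ?J (pt m) (bar_vec d (pt m)) c =
      (if pt n \<in> fst d then tot M ?J (pt n) (bar_vec d (pt n)) c else 0)"
    if "m \<in> {l..r}" "n \<in> {l..r}" "pt m \<preceq> pt n" "pt m \<in> fst d" for m n
  proof -
    have "tot M ?J (pt n) (free_map (Ar M (pt m) (pt n)) (bar_vec d (pt m))) c =
        tot M ?J (pt m) (bar_vec d (pt m)) c"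
      using that d(1) by (intro tot_free_map bar_vec_closed) auto
    then show ?thesis
      using free_map_bar_vec[OF pt_in_ZZ pt_in_ZZ that(3) d(1) that(4)] by (auto simp: tot_zero)
  qed
  have adj: "pt n \<preceq> pt (n + 1) \<or> pt (n + 1) \<preceq> pt n" for n by (simp add: pt_le_iff)
  have const: "\<eta> (pt n) (s (pt n)) d = \<eta> (pt l) (s (pt l)) d \<and>
      tot M ?J (pt n) (bar_vec d (pt n)) c = tot M ?J (pt l) (bar_vec d (pt l)) c"
    if "l \<le> n" "n \<le> k" for n
    using that
  proof (induction n rule: int_ge_induct)
    case (step n)
    then have "n \<in> {l..r}" "n + 1 \<in> {l..r}" "pt n \<in> fst d" "pt (n + 1) \<in> fst d"
      using k(2,3) by auto
    then have "\<eta> (pt (n + 1)) (s (pt (n + 1))) d = \<eta> (pt n) (s (pt n)) d \<and>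
        tot M ?J (pt (n + 1)) (bar_vec d (pt (n + 1))) c = tot M ?J (pt n) (bar_vec d (pt n)) c"
      using adj[of n] \<eta>_le[of n "n + 1"] \<eta>_le[of "n + 1" n] tot_le[of n "n + 1"] tot_le[of "n + 1" n]
      by auto
    then show ?case using step by simp
  qed simp
  have at_k: "\<eta> (pt k) (s (pt k)) d \<noteq> 0"
      "tot M ?J (pt l) (bar_vec d (pt l)) c = tot M ?J (pt k) (bar_vec d (pt k)) c"
    using const[OF k(1) order_refl] nz by auto
  have kr: "k \<in> {l..r}" "k + 1 \<in> {l..r}" using k by auto
  have "\<not> pt (k + 1) \<preceq> pt k" using \<eta>_le[OF kr(2,1)] at_k(1) k(4) by auto
  then have "tot M ?J (pt k) (bar_vec d (pt k)) c = 0"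
    using adj[of k] tot_le[OF kr] k by auto
  then show ?thesis using at_k by simp
qed

lemma card_bars_eq_Full:
  assumes lr: "l \<le> r"
  shows "finite {d \<in> bars B. pt ` {l..r} \<subseteq> fst d}"
    and "card {d \<in> bars B. pt ` {l..r} \<subseteq> fst d} = Full M (pt ` {l..r})"
proof -
  let ?J = "pt ` {l..r}"
  let ?C = "full_comps M ?J"
  let ?D = "{d \<in> bars B. ?J \<subseteq> fst d}"
  let ?X = "Ob M (pt l)"
  have C: "finite ?C" by (rule finite_full_comps)
  have ptl: "pt l \<in> ?J" using lr by simp
  have "\<forall>c\<in>?C. \<exists>u x. u \<in> ?X \<and> set_colim_in M ?J (pt l) u = c \<and>
      x \<in> sections ?J \<and> x (pt l) = (delta u :: 'a \<Rightarrow> 'k)"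
    using ex_section_full lr by blast
  then obtain u s where us: "\<And>c. c \<in> ?C \<Longrightarrow> u c \<in> ?X"
      "\<And>c. c \<in> ?C \<Longrightarrow> set_colim_in M ?J (pt l) (u c) = c"
      "\<And>c. c \<in> ?C \<Longrightarrow> s c \<in> sections ?J"
      "\<And>c. c \<in> ?C \<Longrightarrow> s c (pt l) = (delta (u c) :: 'a \<Rightarrow> 'k)"
    by metis
  define P where "P d c = \<eta> (pt l) (delta (u c)) d" for d c
  define Q where "Q c d = tot M ?J (pt l) (bar_vec d (pt l)) c" for c d
  \<comment> \<open>Expand the vector of \<open>d'\<close> in elements at the left end and group
    them by component. The coordinate on \<open>d\<close> is constant on each group, which leaves a
    total as the other factor; it vanishes unless the component is full.\<close>
  have PQ: "(\<Sum>c\<in>?C. P d c * Q c d') = (if d = d' then 1 else 0)" if d: "d \<in> ?D" "d' \<in> ?D" for d d'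
  proof -
    let ?v = "bar_vec d' (pt l)"
    let ?cl = "set_colim_in M ?J (pt l)"
    let ?g = "\<lambda>u. ?v u * \<eta> (pt l) (delta u) d"
    have dB: "d \<in> bars B" "d' \<in> bars B" "?J \<subseteq> fst d" "?J \<subseteq> fst d'" using d by auto
    have inv: "\<eta> (pt l) (delta w) d = \<eta> (pt l) (delta w') d"
      if "w \<in> ?X" "w' \<in> ?X" "?cl w = ?cl w'" for w w'
      using \<eta>_delta_glue[OF dB(1,3), of l w' "pt l" w] that unfolding set_colim_in_eq_iff
      by (blast intro: glue_sym)
    have sec: "bar_vec d' \<in> sections ?J" by (rule bar_vec_section[OF dB(2,4)])
    have v: "?v \<in> carrier (free_vs ?X)" using sec ptl unfolding sections_def by blast
    have "\<eta> (pt l) ?v d = (\<Sum>u\<in>?X. ?g u)"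
      by (subst free_vs_expansion[OF _ v]) (auto intro!: \<eta>_sum dB(1))
    also have "\<dots> = (\<Sum>c\<in>?cl ` ?X. \<Sum>u\<in>{u \<in> ?X. ?cl u = c}. ?g u)"
      by (rule sum.image_gen) simp
    also have "\<dots> = (\<Sum>c\<in>?C. \<Sum>u\<in>{u \<in> ?X. ?cl u = c}. ?g u)"
    proof (rule sum.mono_neutral_right)
      show "?C \<subseteq> ?cl ` ?X" using us(1,2) by force
      show "\<forall>c\<in>?cl ` ?X - ?C. (\<Sum>u\<in>{u \<in> ?X. ?cl u = c}. ?g u) = 0"
      proof
        fix c assume c: "c \<in> ?cl ` ?X - ?C"
        then obtain w where w: "w \<in> ?X" "c = ?cl w" by blast
        have "(\<Sum>u\<in>{u \<in> ?X. ?cl u = c}. ?g u) = (\<Sum>u\<in>{u \<in> ?X. ?cl u = c}. ?v u * \<eta> (pt l) (delta w) d)"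
          by (intro sum.cong refl arg_cong2[where f = "(*)"] inv) (use w in simp_all)
        also have "\<dots> = tot M ?J (pt l) ?v c * \<eta> (pt l) (delta w) d"
          by (simp add: tot_def sum_distrib_right)
        also have "\<dots> = 0" using tot_section_not_full[OF sec ptl] c by simp
        finally show "(\<Sum>u\<in>{u \<in> ?X. ?cl u = c}. ?g u) = 0" .
      qed
    qed simp
    also have "\<dots> = (\<Sum>c\<in>?C. P d c * Q c d')"
    proof (rule sum.cong[OF refl])
      fix c assume c: "c \<in> ?C"
      have "(\<Sum>u\<in>{u \<in> ?X. ?cl u = c}. ?g u) = (\<Sum>u\<in>{u \<in> ?X. ?cl u = c}. ?v u * P d c)"
        unfolding P_def
        by (intro sum.cong refl arg_cong2[where f = "(*)"] inv) (use us(1,2)[OF c] in simp_all)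
      then show "(\<Sum>u\<in>{u \<in> ?X. ?cl u = c}. ?g u) = P d c * Q c d'"
        by (simp add: Q_def tot_def sum_distrib_left mult.commute)
    qed
    finally have "(\<Sum>c\<in>?C. P d c * Q c d') = \<eta> (pt l) ?v d" by simp
    then show ?thesis using \<eta>_bar_vec[OF _ dB(2) _ dB(1), of "pt l"] dB(4) ptl by auto
  qed
  have bound: "card D' \<le> card ?C" if "finite D'" "D' \<subseteq> ?D" for D'
  proof (rule card_le_of_left_inverse[OF C that(1)])
    show "(\<Sum>c\<in>?C. P d c * Q c d') = (if d = d' then 1 else 0)" if "d \<in> D'" "d' \<in> D'" for d d'
      by (rule PQ; rule subsetD[OF \<open>D' \<subseteq> ?D\<close>]; rule that)
  qed
  show fin: "finite ?D"
    by (rule finite_if_finite_subsets_card_bdd[THEN conjunct1]) (rule bound)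
  \<comment> \<open>Conversely, expand the element \<open>u c'\<close> in bar vectors. It is the
    left end of the section \<open>s c'\<close>, so bars that do not contain the interval drop out
    by \<open>tot_bar_vec_zero\<close>.\<close>
  have QP: "(\<Sum>d\<in>?D. Q c d * P d c') = (if c = c' then 1 else 0)" if c: "c \<in> ?C" "c' \<in> ?C" for c c'
  proof -
    let ?f = "delta (u c') :: 'a \<Rightarrow> 'k"
    let ?S = "{d \<in> bars B. \<eta> (pt l) ?f d \<noteq> 0}"
    have f: "?f \<in> carrier (free_vs ?X)" using us(1)[OF c(2)] by simp
    have "(if c = c' then 1 else 0) = tot M ?J (pt l) ?f c"
      using us(1,2)[OF c(2)] by (simp add: tot_delta eq_commute)
    also have "\<dots> = (\<Sum>d\<in>?S. P d c' * Q c d)"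
      by (subst bar_vec_expansion[OF pt_in_ZZ f]) (simp add: tot_sum P_def Q_def)
    also have "\<dots> = (\<Sum>d\<in>?D. P d c' * Q c d)"
    proof (rule sum.mono_neutral_cong)
      show "finite ?S" using \<eta>_closed[OF pt_in_ZZ f] unfolding carrier_bar_diagram by blast
      show "P d c' * Q c d = 0" if "d \<in> ?D - ?S" for d using that by (auto simp: P_def)
      show "P d c' * Q c d = 0" if "d \<in> ?S - ?D" for d
      proof -
        have "Q c d = 0"
          unfolding Q_def
          using that us(3,4)[OF c(2)] by (intro tot_bar_vec_zero[of d l r "s c'"] lr) auto
        then show ?thesis by simp
      qed
    qed (use fin in auto)
    finally show ?thesis by (simp add: mult.commute)
  qed
  have "card ?C \<le> card ?D"
    by (rule card_le_of_left_inverse[OF fin C QP])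
  then show "card ?D = Full M ?J"
    using bound[OF fin] by (simp add: Full_def full_comps_def)
qed

end

section \<open>Inclusion-exclusion over bars\<close>

lemma is_barcodeE:
  fixes B :: "point set \<Rightarrow> nat"
  assumes M: "finset_functor M" and B: "is_barcode (free_diagram M :: ('k::field, 'a \<Rightarrow> 'k) vec_diagram) B"
  obtains \<eta> :: "point \<Rightarrow> ('a \<Rightarrow> 'k::field) \<Rightarrow> point set \<times> nat \<Rightarrow> 'k" where "barcode_iso M B \<eta>"
proof -
  from B obtain \<eta> :: "point \<Rightarrow> ('a \<Rightarrow> 'k) \<Rightarrow> point set \<times> nat \<Rightarrow> 'k" where
    "\<forall>p\<in>ZZ. \<eta> p \<in> LinearCombinations.module_hom class_ring (free_vs (Ob M p)) (Ob (bar_diagram B) p) \<and>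
       bij_betw (\<eta> p) (carrier (free_vs (Ob M p))) (carrier (Ob (bar_diagram B) p))"
    "\<forall>p\<in>ZZ. \<forall>q\<in>ZZ. p \<preceq> q \<longrightarrow> (\<forall>v\<in>carrier (free_vs (Ob M p)).
       \<eta> q (free_map (Ar M p q) v) = Ar (bar_diagram B) p q (\<eta> p v))"
    unfolding is_barcode_def vec_diagram_iso_def free_diagram_def diagram.simps by blast
  then have "barcode_iso M B \<eta>"
    by (intro barcode_iso.intro finite_sets_on_ZZ.intro barcode_iso_axioms.intro M) blast+
  then show thesis by (rule that)
qed

text \<open>Stated additively because subtraction of natural numbers truncates.\<close>

lemma card_bars_eq:
  assumes B: "\<And>K. K \<notin> Int_ZZ \<Longrightarrow> B K = 0" and lr: "l \<le> r"
    and fin: "finite {d \<in> bars B. pt ` {l..r} \<subseteq> fst d}"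
  shows "card {d \<in> bars B. pt ` {l..r} \<subseteq> fst d} + card {d \<in> bars B. pt ` {l - 1..r + 1} \<subseteq> fst d} =
    card {d \<in> bars B. pt ` {l - 1..r} \<subseteq> fst d} + card {d \<in> bars B. pt ` {l..r + 1} \<subseteq> fst d} +
    B (pt ` {l..r})"
proof -
  define D where "D a b = {d \<in> bars B. pt ` {a..b} \<subseteq> fst d}" for a b
  define I where "I = pt ` {l..r}"
  have "{l - 1..r} = insert (l - 1) {l..r}" "{l..r + 1} = insert (r + 1) {l..r}"
    "{l - 1..r + 1} = insert (l - 1) (insert (r + 1) {l..r})"
    using lr by auto
  then have sub: "D (l - 1) r = {d \<in> D l r. pt (l - 1) \<in> fst d}"
      "D l (r + 1) = {d \<in> D l r. pt (r + 1) \<in> fst d}"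
      "D (l - 1) (r + 1) = D (l - 1) r \<inter> D l (r + 1)"
    unfolding D_def by auto
  have fin: "finite (D l r)" using fin by (simp add: D_def)
  have rest: "D l r - (D (l - 1) r \<union> D l (r + 1)) = {I} \<times> {..<B I}"
  proof (rule Set.set_eqI)
    fix d :: "point set \<times> nat"
    obtain K n where d: "d = (K, n)" by (cases d)
    have "K = I" if "n < B K" "pt ` {l..r} \<subseteq> K" "pt (l - 1) \<notin> K" "pt (r + 1) \<notin> K"
      unfolding I_def using that B[of K] lr by (intro Int_ZZ_eqI) auto
    then show "d \<in> D l r - (D (l - 1) r \<union> D l (r + 1)) \<longleftrightarrow> d \<in> {I} \<times> {..<B I}"
      unfolding sub by (auto simp: D_def d I_def)
  qed
  have "card (D l r) = card (D l r - (D (l - 1) r \<union> D l (r + 1))) + card (D (l - 1) r \<union> D l (r + 1))"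
  proof -
    have U: "D (l - 1) r \<union> D l (r + 1) \<subseteq> D l r" by (auto simp: sub)
    show ?thesis
      using card_Diff_subset[OF finite_subset[OF U fin] U] card_mono[OF fin U] by linarith
  qed
  moreover have "card (D (l - 1) r) + card (D l (r + 1)) =
      card (D (l - 1) r \<union> D l (r + 1)) + card (D (l - 1) (r + 1))"
    unfolding sub(3) using fin by (intro card_Un_Int) (auto simp: sub)
  ultimately show ?thesis
    unfolding D_def[symmetric] unfolding I_def[symmetric] by (simp add: rest)
qed

theorem corollary4p10:
  fixes M :: "'a set_diagram"
    and I :: "point set"
    and a b :: point
  assumes "finset_functor M"
    and "I \<in> Int_ZZ"
    and "finite I"
    and "nbd I = {a, b}"
  shows "(\<forall>B. is_barcode (free_diagram M :: ('k::field, 'a \<Rightarrow> 'k) vec_diagram) B \<longrightarrow>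
            int (B I) = int (Full M I) - int (Full M (I \<union> {a})) - int (Full M (I \<union> {b}))
                          + int (Full M (I \<union> {a, b})))
         \<and> int (Full M I) - int (Full M (I \<union> {a})) - int (Full M (I \<union> {b}))
             + int (Full M (I \<union> {a, b}))
           = dgm (free_diagram M :: ('k::field, 'a \<Rightarrow> 'k) vec_diagram) I"
proof -
  let ?G = "free_diagram M :: ('k, 'a \<Rightarrow> 'k) vec_diagram"
  interpret finite_sets_on_ZZ M by (rule finite_sets_on_ZZ.intro[OF assms(1)])
  obtain l r where lr: "l \<le> r" and I: "I = pt ` {l..r}"
    using finite_Int_ZZ_eq[OF assms(2,3)] .
  define L R where "L = pt (l - 1)" and "R = pt (r + 1)"
  \<comment> \<open>This keeps the four subsets of \<open>nbd I\<close> in the sum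
    \<open>dgm\<close> distinct.\<close>
  have "L \<noteq> R" using lr by (simp add: L_def R_def)
  have nbd: "nbd I = {L, R}" using nbd_pt[OF lr] by (simp add: I L_def R_def)
  have "{l - 1..r} = insert (l - 1) {l..r}" "{l..r + 1} = insert (r + 1) {l..r}"
    "{l - 1..r + 1} = insert (l - 1) (insert (r + 1) {l..r})"
    using lr by auto
  then have IL: "I \<union> {L} = pt ` {l - 1..r}" and IR: "I \<union> {R} = pt ` {l..r + 1}"
    and ILR: "I \<union> {L, R} = pt ` {l - 1..r + 1}"
    by (auto simp: I L_def R_def)
  \<comment> \<open>Which of \<open>a\<close> and \<open>b\<close> is the left neighbour is unknown,
    but the formula is symmetric in them.\<close>
  have ab: "a = L \<and> b = R \<or> a = R \<and> b = L"
    using nbd assms(4) by (auto simp: doubleton_eq_iff)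
  let ?F = "int (Full M I) - int (Full M (I \<union> {L})) - int (Full M (I \<union> {R})) + int (Full M (I \<union> {L, R}))"
  have swap: "int (Full M I) - int (Full M (I \<union> {a})) - int (Full M (I \<union> {b})) + int (Full M (I \<union> {a, b})) = ?F"
    using ab by (elim disjE) (auto simp: insert_commute)
  have "int (B I) = ?F" if barcode: "is_barcode ?G B" for B
  proof -
    obtain \<eta> :: "point \<Rightarrow> ('a \<Rightarrow> 'k) \<Rightarrow> point set \<times> nat \<Rightarrow> 'k" where "barcode_iso M B \<eta>"
      using is_barcodeE[OF assms(1) barcode] .
    then interpret barcode_iso M B \<eta> .
    have "B K = 0" if "K \<notin> Int_ZZ" for K
      using barcode that by (simp add: is_barcode_def)
    then have "card {d \<in> bars B. pt ` {l..r} \<subseteq> fst d} + card {d \<in> bars B. pt ` {l - 1..r + 1} \<subseteq> fst d} =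
        card {d \<in> bars B. pt ` {l - 1..r} \<subseteq> fst d} + card {d \<in> bars B. pt ` {l..r + 1} \<subseteq> fst d} +
        B (pt ` {l..r})"
      using lr card_bars_eq_Full(1)[OF lr] by (rule card_bars_eq)
    then have "Full M (pt ` {l..r}) + Full M (pt ` {l - 1..r + 1}) =
        Full M (pt ` {l - 1..r}) + Full M (pt ` {l..r + 1}) + B (pt ` {l..r})"
      using card_bars_eq_Full(2)[of l r] card_bars_eq_Full(2)[of "l - 1" "r + 1"]
        card_bars_eq_Full(2)[of "l - 1" r] card_bars_eq_Full(2)[of l "r + 1"] lr by simp
    then show ?thesis unfolding IL IR ILR unfolding I by simp
  qed
  moreover have "dgm ?G I = ?F"
  proof -
    have rk: "rk ?G (pt ` {l'..r'}) = Full M (pt ` {l'..r'})" if "l' \<le> r'" for l' r'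
      using rk_eq_Full[OF that refl] .
    have "Pow {L, R} = {{}, {L}, {R}, {L, R}}" by auto
    then have "dgm ?G I = int (rk ?G I) - int (rk ?G (I \<union> {L})) - int (rk ?G (I \<union> {R})) + int (rk ?G (I \<union> {L, R}))"
      using \<open>L \<noteq> R\<close> by (simp add: dgm_def nbd doubleton_eq_iff)
    also have "\<dots> = ?F"
      unfolding IL IR ILR unfolding I using lr by (simp add: rk)
    finally show ?thesis .
  qed
  ultimately show ?thesis unfolding swap by simp
qed

end
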